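(* Let $(M,J,g)$ be a strict nearly Kähler manifold of dimension six with type constant $\alpha$, and let $F_t:L\to M$, $t\in(-\epsilon,\epsilon)$, be a smooth variation of Lagrangian immersions with variation vector field $V=\frac{d}{dt}F_t$. Then the variation $1$-form $\theta=V\lrcorner\,\omega\in\Omega^1(L)$, i.e. $\theta(X)=\omega(V,dF_t(X))$ for $X\in TL$, is a coclosed eigenform of the Hodge-Laplacian of $L$ (with respect to the metric $F_t^*g$) with eigenvalue $\lambda=9\alpha$; that is, $$\delta\theta=0,\qquad \Delta_{\mathrm{Hodge}}\theta=(d\delta+\delta d)\theta=9\alpha\,\theta.$$
   Context: An almost Hermitian manifold $(M,J,g)$, $g=\langle\cdot,\cdot\rangle$, with Levi-Civita connection $\nabla$ is nearly Kähler if $(\nabla_XJ)X=0$ for all $X\in TM$, and strict nearly Kähler if in addition $\nabla_XJ\neq0$ for all $X\neq0$. With $\omega(X,Y)=\langle JX,Y\rangle$, an immersion $F:L\to M$ is Lagrangian if $F^*\omega=0$ and $2\dim L=\dim M$. For a strict nearly Kähler six-manifold the type constant is the constant $\alpha>0$ with $$\langle(\nabla_XJ)Y,(\nabla_XJ)Y\rangle=\alpha\left(|X|^2|Y|^2-\langle X,Y\rangle^2-\langle X,JY\rangle^2\right)$$ for all tangent vectors $X,Y$ at a common point. *)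

theory Defs
  imports "HOL-Analysis.Analysis"
begin

section \<open>Smooth maps between Euclidean spaces\<close>

text \<open>Intended for open \<open>S\<close> and finite-dimensional domains, where continuity of all iterated
  directional derivatives is the usual notion of class \<open>C\<^sup>k\<close>.\<close>

primrec Ck_on :: "nat \<Rightarrow> 'a::real_normed_vector set \<Rightarrow> ('a \<Rightarrow> 'b::real_normed_vector) \<Rightarrow> bool" where
  "Ck_on 0 S f \<longleftrightarrow> continuous_on S f"
| "Ck_on (Suc k) S f \<longleftrightarrow> (\<forall>x\<in>S. f differentiable (at x)) \<and>
     (\<forall>v. Ck_on k S (\<lambda>x. frechet_derivative f (at x) v))"

definition smooth_on :: "'a::real_normed_vector set \<Rightarrow> ('a \<Rightarrow> 'b::real_normed_vector) \<Rightarrow> bool" where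
  "smooth_on S f \<longleftrightarrow> (\<forall>k. Ck_on k S f)"


section \<open>Smooth manifolds\<close>

datatype ('m, 'e) chart = Chart (chart_dom: "'m set") (chart_map: "'m \<Rightarrow> 'e")

definition chart_image :: "('m, 'e) chart \<Rightarrow> 'e set" where
  "chart_image c = chart_map c ` chart_dom c"

definition chart_inv :: "('m, 'e) chart \<Rightarrow> 'e \<Rightarrow> 'm" where
  "chart_inv c = inv_into (chart_dom c) (chart_map c)"

text \<open>A manifold is given by an atlas; its underlying set is the union of the chart domains.\<close>

definition points :: "('m, 'e) chart set \<Rightarrow> 'm set" where
  "points A = (\<Union>c\<in>A. chart_dom c)"

definition local_rep :: "('m, 'e) chart \<Rightarrow> ('n, 'f) chart \<Rightarrow> ('m \<Rightarrow> 'n) \<Rightarrow> 'e \<Rightarrow> 'f" where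
  "local_rep c d f = chart_map d \<circ> f \<circ> chart_inv c"

definition topological_chart :: "('m::topological_space, 'e::euclidean_space) chart \<Rightarrow> bool" where
  "topological_chart c \<longleftrightarrow> open (chart_dom c) \<and> open (chart_image c) \<and>
     homeomorphism (chart_dom c) (chart_image c) (chart_map c) (chart_inv c)"

definition smooth_manifold ::
    "('m::{t2_space, second_countable_topology}, 'e::euclidean_space) chart set \<Rightarrow> bool" where
  "smooth_manifold A \<longleftrightarrow> (\<forall>c\<in>A. topological_chart c) \<and>
     (\<forall>c\<in>A. \<forall>d\<in>A. smooth_on (chart_map c ` (chart_dom c \<inter> chart_dom d)) (local_rep c d id))"

definition smooth_map ::
    "('m::topological_space, 'e::euclidean_space) chart set \<Rightarrow>
     ('n::topological_space, 'f::euclidean_space) chart set \<Rightarrow> ('m \<Rightarrow> 'n) \<Rightarrow> bool" where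
  "smooth_map A B f \<longleftrightarrow> continuous_on (points A) f \<and> f ` points A \<subseteq> points B \<and>
     (\<forall>c\<in>A. \<forall>d\<in>B. smooth_on (chart_map c ` (chart_dom c \<inter> f -` chart_dom d)) (local_rep c d f))"

definition interval_atlas :: "real \<Rightarrow> real \<Rightarrow> (real, real) chart set" where
  "interval_atlas a b = {Chart {a<..<b} id}"

definition prod_atlas ::
    "('m, 'e) chart set \<Rightarrow> ('n, 'f) chart set \<Rightarrow> ('m \<times> 'n, 'e \<times> 'f) chart set" where
  "prod_atlas A B = {Chart (chart_dom c \<times> chart_dom d) (map_prod (chart_map c) (chart_map d)) |c d.
     c \<in> A \<and> d \<in> B}"

text \<open>Tangent vectors are represented by their components in a chart. This is the change of
  components from chart \<open>c\<close> to chart \<open>d\<close> at the point with \<open>c\<close>-coordinates \<open>x\<close>; more generally,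
  for a map \<open>f\<close>, it is the differential of \<open>f\<close> in the charts \<open>c\<close> and \<open>d\<close>.\<close>

definition local_diff ::
    "('m, 'e::euclidean_space) chart \<Rightarrow> ('n, 'f::euclidean_space) chart \<Rightarrow> ('m \<Rightarrow> 'n) \<Rightarrow>
     'e \<Rightarrow> 'e \<Rightarrow> 'f" where
  "local_diff c d f x = frechet_derivative (local_rep c d f) (at x)"

definition chart_at :: "('m, 'e) chart set \<Rightarrow> 'm \<Rightarrow> ('m, 'e) chart" where
  "chart_at A p = (SOME c. c \<in> A \<and> p \<in> chart_dom c)"


section \<open>Tensor fields\<close>

text \<open>Tensor fields are families of component functions, one for each chart of the atlas, taking
  the coordinates of the base point as first argument. A differential form takes a list of
  tangent vectors, the length of the list being the degree.\<close>

type_synonym ('m, 'e) bilinear_field = "('m, 'e) chart \<Rightarrow> 'e \<Rightarrow> 'e \<Rightarrow> 'e \<Rightarrow> real"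
type_synonym ('m, 'e) endo_field = "('m, 'e) chart \<Rightarrow> 'e \<Rightarrow> 'e \<Rightarrow> 'e"
type_synonym ('m, 'e) form_field = "('m, 'e) chart \<Rightarrow> 'e \<Rightarrow> 'e list \<Rightarrow> real"

definition smooth_bilinear_field ::
    "('m, 'e::euclidean_space) chart set \<Rightarrow> ('m, 'e) bilinear_field \<Rightarrow> bool" where
  "smooth_bilinear_field A b \<longleftrightarrow>
     (\<forall>c\<in>A. (\<forall>x\<in>chart_image c. bilinear (b c x)) \<and>
        (\<forall>u v. smooth_on (chart_image c) (\<lambda>x. b c x u v))) \<and>
     (\<forall>c\<in>A. \<forall>d\<in>A. \<forall>p \<in> chart_dom c \<inter> chart_dom d. \<forall>u v.
        b c (chart_map c p) u v =
        b d (chart_map d p) (local_diff c d id (chart_map c p) u)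
                            (local_diff c d id (chart_map c p) v))"

definition smooth_endo_field ::
    "('m, 'e::euclidean_space) chart set \<Rightarrow> ('m, 'e) endo_field \<Rightarrow> bool" where
  "smooth_endo_field A J \<longleftrightarrow>
     (\<forall>c\<in>A. (\<forall>x\<in>chart_image c. linear (J c x)) \<and>
        (\<forall>u. smooth_on (chart_image c) (\<lambda>x. J c x u))) \<and>
     (\<forall>c\<in>A. \<forall>d\<in>A. \<forall>p \<in> chart_dom c \<inter> chart_dom d. \<forall>u.
        local_diff c d id (chart_map c p) (J c (chart_map c p) u) =
        J d (chart_map d p) (local_diff c d id (chart_map c p) u))"

text \<open>The pullback \<open>f\<^sup>*b\<close>. By the transformation law of \<open>b\<close>, the choice of chart in the target is
  irrelevant.\<close>

definition pullback ::
    "('n, 'f::euclidean_space) chart set \<Rightarrow> ('m \<Rightarrow> 'n) \<Rightarrow> ('n, 'f) bilinear_field \<Rightarrow>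
     ('m, 'e::euclidean_space) bilinear_field" where
  "pullback B f b c x u v =
     (let d = chart_at B (f (chart_inv c x))
      in b d (local_rep c d f x) (local_diff c d f x u) (local_diff c d f x v))"


section \<open>Riemannian geometry\<close>

definition riemannian_metric ::
    "('m, 'e::euclidean_space) chart set \<Rightarrow> ('m, 'e) bilinear_field \<Rightarrow> bool" where
  "riemannian_metric A g \<longleftrightarrow> smooth_bilinear_field A g \<and>
     (\<forall>c\<in>A. \<forall>x\<in>chart_image c. (\<forall>u v. g c x u v = g c x v u) \<and> (\<forall>u. u \<noteq> 0 \<longrightarrow> 0 < g c x u u))"

text \<open>The Levi-Civita connection in a chart: \<open>christoffel g c x u v\<close> is \<open>\<nabla>\<^sub>u v\<close> for vector fields
  \<open>u\<close>, \<open>v\<close> with constant components. Since such fields commute, symmetry in \<open>u\<close>, \<open>v\<close> is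
  vanishing of the torsion; the last condition is \<open>\<nabla>g = 0\<close>.\<close>

definition christoffel ::
    "('m, 'e::euclidean_space) bilinear_field \<Rightarrow> ('m, 'e) chart \<Rightarrow> 'e \<Rightarrow> 'e \<Rightarrow> 'e \<Rightarrow> 'e" where
  "christoffel g c x = (THE \<Gamma>. bilinear \<Gamma> \<and> (\<forall>u v. \<Gamma> u v = \<Gamma> v u) \<and>
     (\<forall>u v w. frechet_derivative (\<lambda>y. g c y v w) (at x) u =
        g c x (\<Gamma> u v) w + g c x v (\<Gamma> u w)))"

text \<open>\<open>(\<nabla>\<^sub>uJ)v = \<nabla>\<^sub>u(Jv) - J(\<nabla>\<^sub>uv)\<close>, for \<open>v\<close> with constant components.\<close>

definition cov_deriv_endo ::
    "('m, 'e::euclidean_space) bilinear_field \<Rightarrow> ('m, 'e) endo_field \<Rightarrow>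
     ('m, 'e) chart \<Rightarrow> 'e \<Rightarrow> 'e \<Rightarrow> 'e \<Rightarrow> 'e" where
  "cov_deriv_endo g J c x u v =
     frechet_derivative (\<lambda>y. J c y v) (at x) u + christoffel g c x u (J c x v)
     - J c x (christoffel g c x u v)"

text \<open>\<open>(\<nabla>\<^sub>u\<eta>)(v\<^sub>1,\<dots>,v\<^sub>k) = u(\<eta>(v\<^sub>1,\<dots>,v\<^sub>k)) - \<Sum>\<^sub>i \<eta>(v\<^sub>1,\<dots>,\<nabla>\<^sub>uv\<^sub>i,\<dots>,v\<^sub>k)\<close>\<close>

definition cov_deriv_form ::
    "('m, 'e::euclidean_space) bilinear_field \<Rightarrow> ('m, 'e) form_field \<Rightarrow>
     ('m, 'e) chart \<Rightarrow> 'e \<Rightarrow> 'e \<Rightarrow> 'e list \<Rightarrow> real" where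
  "cov_deriv_form g \<eta> c x u vs =
     frechet_derivative (\<lambda>y. \<eta> c y vs) (at x) u
     - (\<Sum>i<length vs. \<eta> c x (vs[i := christoffel g c x u (vs ! i)]))"

text \<open>\<open>d\<eta>(v\<^sub>0,\<dots>,v\<^sub>k) = \<Sum>\<^sub>i (-1)\<^sup>i v\<^sub>i(\<eta>(v\<^sub>0,\<dots>,v\<^sub>i\<^sub>-\<^sub>1,v\<^sub>i\<^sub>+\<^sub>1,\<dots>,v\<^sub>k))\<close>; the bracket terms vanish for constant
  components.\<close>

definition ext_deriv ::
    "('m, 'e::euclidean_space) form_field \<Rightarrow> ('m, 'e) form_field" where
  "ext_deriv \<eta> c x vs =
     (\<Sum>i<length vs.
        (-1) ^ i * frechet_derivative (\<lambda>y. \<eta> c y (take i vs @ drop (Suc i) vs)) (at x) (vs ! i))"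

definition orthonormal_basis :: "('e::euclidean_space \<Rightarrow> 'e \<Rightarrow> real) \<Rightarrow> 'e set \<Rightarrow> bool" where
  "orthonormal_basis b B \<longleftrightarrow> finite B \<and> span B = UNIV \<and>
     (\<forall>e\<in>B. \<forall>f\<in>B. b e f = (if e = f then 1 else 0))"

text \<open>\<open>\<delta>\<eta> = -\<Sum>\<^sub>e e \<lrcorner> \<nabla>\<^sub>e\<eta>\<close>, the sum over an orthonormal basis, whose choice is irrelevant. This is
  the formal adjoint of \<open>ext_deriv\<close>, without reference to an orientation.\<close>

definition codiff ::
    "('m, 'e::euclidean_space) bilinear_field \<Rightarrow> ('m, 'e) form_field \<Rightarrow> ('m, 'e) form_field" where
  "codiff g \<eta> c x vs =
     - (\<Sum>e \<in> (SOME B. orthonormal_basis (g c x) B). cov_deriv_form g \<eta> c x e (e # vs))"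

definition hodge_laplacian ::
    "('m, 'e::euclidean_space) bilinear_field \<Rightarrow> ('m, 'e) form_field \<Rightarrow> ('m, 'e) form_field" where
  "hodge_laplacian g \<eta> c x vs =
     ext_deriv (codiff g \<eta>) c x vs + codiff g (ext_deriv \<eta>) c x vs"


section \<open>Nearly Kaehler manifolds\<close>

definition almost_hermitian ::
    "('m, 'e::euclidean_space) chart set \<Rightarrow> ('m, 'e) endo_field \<Rightarrow> ('m, 'e) bilinear_field \<Rightarrow> bool"
    where
  "almost_hermitian A J g \<longleftrightarrow> riemannian_metric A g \<and> smooth_endo_field A J \<and>
     (\<forall>c\<in>A. \<forall>x\<in>chart_image c.
        (\<forall>u. J c x (J c x u) = - u) \<and> (\<forall>u v. g c x (J c x u) (J c x v) = g c x u v))"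

definition nearly_kaehler ::
    "('m, 'e::euclidean_space) chart set \<Rightarrow> ('m, 'e) endo_field \<Rightarrow> ('m, 'e) bilinear_field \<Rightarrow> bool"
    where
  "nearly_kaehler A J g \<longleftrightarrow> almost_hermitian A J g \<and>
     (\<forall>c\<in>A. \<forall>x\<in>chart_image c. \<forall>u. cov_deriv_endo g J c x u u = 0)"

definition strict_nearly_kaehler ::
    "('m, 'e::euclidean_space) chart set \<Rightarrow> ('m, 'e) endo_field \<Rightarrow> ('m, 'e) bilinear_field \<Rightarrow> bool"
    where
  "strict_nearly_kaehler A J g \<longleftrightarrow> nearly_kaehler A J g \<and>
     (\<forall>c\<in>A. \<forall>x\<in>chart_image c. \<forall>u. u \<noteq> 0 \<longrightarrow> cov_deriv_endo g J c x u \<noteq> (\<lambda>v. 0))"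

definition type_constant ::
    "('m, 'e::euclidean_space) chart set \<Rightarrow> ('m, 'e) endo_field \<Rightarrow> ('m, 'e) bilinear_field \<Rightarrow>
     real \<Rightarrow> bool" where
  "type_constant A J g \<alpha> \<longleftrightarrow> 0 < \<alpha> \<and>
     (\<forall>c\<in>A. \<forall>x\<in>chart_image c. \<forall>u v.
        g c x (cov_deriv_endo g J c x u v) (cov_deriv_endo g J c x u v) =
        \<alpha> * (g c x u u * g c x v v - (g c x u v)\<^sup>2 - (g c x u (J c x v))\<^sup>2))"

definition kaehler_form ::
    "('m, 'e) endo_field \<Rightarrow> ('m, 'e) bilinear_field \<Rightarrow> ('m, 'e) bilinear_field" where
  "kaehler_form J g c x u v = g c x (J c x u) v"


section \<open>Lagrangian immersions and their variations\<close>

definition immersion ::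
    "('l::topological_space, 'f::euclidean_space) chart set \<Rightarrow>
     ('m::topological_space, 'e::euclidean_space) chart set \<Rightarrow> ('l \<Rightarrow> 'm) \<Rightarrow> bool" where
  "immersion L M f \<longleftrightarrow> smooth_map L M f \<and>
     (\<forall>c\<in>L. \<forall>d\<in>M. \<forall>p\<in>chart_dom c. f p \<in> chart_dom d \<longrightarrow> inj (local_diff c d f (chart_map c p)))"

definition lagrangian_immersion ::
    "('l::topological_space, 'f::euclidean_space) chart set \<Rightarrow>
     ('m::topological_space, 'e::euclidean_space) chart set \<Rightarrow>
     ('m, 'e) endo_field \<Rightarrow> ('m, 'e) bilinear_field \<Rightarrow> ('l \<Rightarrow> 'm) \<Rightarrow> bool" where
  "lagrangian_immersion L M J g f \<longleftrightarrow> immersion L M f \<and> 2 * DIM('f) = DIM('e) \<and>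
     (\<forall>c\<in>L. \<forall>x\<in>chart_image c. \<forall>u v. pullback M f (kaehler_form J g) c x u v = 0)"

definition smooth_variation ::
    "('l::topological_space, 'f::euclidean_space) chart set \<Rightarrow>
     ('m::topological_space, 'e::euclidean_space) chart set \<Rightarrow> real \<Rightarrow> (real \<Rightarrow> 'l \<Rightarrow> 'm) \<Rightarrow> bool"
    where
  "smooth_variation L M \<epsilon> F \<longleftrightarrow>
     smooth_map (prod_atlas (interval_atlas (- \<epsilon>) \<epsilon>) L) M (\<lambda>(t, p). F t p)"

text \<open>The components in the chart \<open>d\<close> of the variation field \<open>V = d/dt F\<^sub>t\<close> at the point \<open>p\<close>.\<close>

definition variation_field ::
    "('m, 'e::euclidean_space) chart \<Rightarrow> (real \<Rightarrow> 'l \<Rightarrow> 'm) \<Rightarrow> real \<Rightarrow> 'l \<Rightarrow> 'e" where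
  "variation_field d F t p = vector_derivative (\<lambda>s. chart_map d (F s p)) (at t)"

text \<open>\<open>\<theta>(X) = \<omega>(V, dF\<^sub>t(X))\<close>, as a form of degree one. As for \<open>pullback\<close>, the chart chosen in the
  target is irrelevant.\<close>

definition variation_form ::
    "('m, 'e::euclidean_space) chart set \<Rightarrow> ('m, 'e) endo_field \<Rightarrow> ('m, 'e) bilinear_field \<Rightarrow>
     (real \<Rightarrow> 'l \<Rightarrow> 'm) \<Rightarrow> real \<Rightarrow> ('l, 'f::euclidean_space) form_field" where
  "variation_form M J g F t c x vs =
     (case vs of
        [u] \<Rightarrow> (let p = chart_inv c x; d = chart_at M (F t p)
                in kaehler_form J g d (chart_map d (F t p))
                     (variation_field d F t p) (local_diff c d (F t) x u))
      | _ \<Rightarrow> 0)"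

end

theory Submission
  imports Defs
begin

text \<open>Let \<open>\<omega>(X, Y) = \<langle>JX, Y\<rangle>\<close> and \<open>\<sigma>(X, Y, Z) = \<langle>(\<nabla>\<^sub>XJ)Y, Z\<rangle>\<close>. On a nearly Kaehler manifold \<open>\<sigma>\<close> is
  a three-form, \<open>\<sigma>(X, JY, Z) = \<sigma>(X, Y, JZ)\<close>, and \<open>d\<omega> = 3\<sigma>\<close> (\<open>ext_deriv_omega\<close>). Pull \<open>\<omega>\<close> back to a
  two-form \<open>\<Omega>\<close> along the whole variation \<open>(s, p) \<mapsto> F\<^sub>s p\<close>. Since every \<open>F\<^sub>s\<close> is Lagrangian, \<open>\<Omega>\<close> vanishes on
  pairs of vectors tangent to the slices \<open>s = const\<close>, while \<open>\<theta>(X) = \<Omega>(\<partial>\<^sub>t, X)\<close>. The identity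
  \<open>d\<Omega> = 3 F\<^sup>*\<sigma>\<close> (\<open>ext_deriv_2_pullback\<close>) therefore says two things: on three vectors tangent to a slice,
  that \<open>\<sigma>\<close> vanishes on \<open>L\<close>; on \<open>\<partial>\<^sub>t, X, Y\<close>, that \<open>d\<theta>(X, Y) = -3\<sigma>(V, X, Y)\<close>.

  Let \<open>\<psi>(X, Y, Z) = \<sigma>(JX, Y, Z)\<close>, a three-form on \<open>L\<close>. Only the normal part \<open>JW\<close> of \<open>V\<close> contributes to
  \<open>\<sigma>(V, X, Y)\<close>, and \<open>W = -\<theta>\<^sup>#\<close>, so that \<open>d\<theta> = 3\<psi>(\<theta>\<^sup>#, \<cdot>, \<cdot>)\<close> (\<open>normal_contraction\<close>). For tangent \<open>X, Y\<close> the vector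
  \<open>(\<nabla>\<^sub>XJ)Y\<close> is normal to \<open>L\<close>, with components \<open>\<psi>(e, X, Y)\<close>; the type constant gives its length, and hence
  \<open>\<psi>(e\<^sub>1, e\<^sub>2, e\<^sub>3)\<^sup>2 = \<alpha>\<close> for orthonormal frames of \<open>L\<close> (\<open>psi_norm\<close>). As \<open>dim L = 3\<close>, \<open>\<psi>\<close> is locally
  \<open>\<surd>\<alpha>\<close> times a volume form, and the equation for \<open>d\<theta>\<close> reads \<open>*d\<theta> = 3\<surd>\<alpha> \<theta>\<close>. Applying \<open>d*\<close> gives \<open>\<delta>\<theta> = 0\<close>, and
  applying \<open>*d\<close> gives \<open>\<delta>d\<theta> = 9\<alpha>\<theta>\<close>.

  The last step, which depends on the geometry of \<open>L\<close> alone, is the locale \<open>curl_eigenform\<close>. To avoid choosing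
  an orientation it does not use the star operator. Instead the two identities
  \<open>\<psi>(e\<^sub>1, e\<^sub>2, e\<^sub>3)\<^sup>2 = \<alpha> det \<langle>e\<^sub>i, e\<^sub>j\<rangle>\<close> and
  \<open>3\<psi>(e\<^sub>1, e\<^sub>2, e\<^sub>3) \<theta>(u) = \<langle>u, e\<^sub>1\<rangle> d\<theta>(e\<^sub>2, e\<^sub>3) + \<langle>u, e\<^sub>2\<rangle> d\<theta>(e\<^sub>3, e\<^sub>1) + \<langle>u, e\<^sub>3\<rangle> d\<theta>(e\<^sub>1, e\<^sub>2)\<close>
  are differentiated for a frame \<open>e\<^sub>1, e\<^sub>2, e\<^sub>3\<close> of constant fields that is orthonormal at a
  single point. The first is parallelism of \<open>\<psi>\<close>; in the combinations that form \<open>\<delta>\<theta>\<close> and \<open>\<delta>d\<theta>\<close> all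
  Christoffel symbols cancel.\<close>

section \<open>Calculus of smooth maps\<close>

abbreviation fd :: "('a::real_normed_vector \<Rightarrow> 'b::real_normed_vector) \<Rightarrow> 'a \<Rightarrow> 'a \<Rightarrow> 'b" where
  "fd f x \<equiv> frechet_derivative f (at x)"

lemma fd_eqI: "(f has_derivative f') (at x) \<Longrightarrow> fd f x = f'"
  by (metis frechet_derivative_at)

lemma fd_has_derivative: "f differentiable (at x) \<Longrightarrow> (f has_derivative fd f x) (at x)"
  by (simp add: frechet_derivative_works)

lemma fd_cong:
  assumes "open S" "x \<in> S" "\<And>y. y \<in> S \<Longrightarrow> f y = g y"
  shows "fd f x = fd g x"
proof -
  have "(f has_derivative D) (at x) \<longleftrightarrow> (g has_derivative D) (at x)" for D
    using assms by (metis has_derivative_transform_within_open)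
  then show ?thesis unfolding frechet_derivative_def by simp
qed

lemma differentiable_cong_open:
  assumes "open S" "x \<in> S" "\<And>y. y \<in> S \<Longrightarrow> f y = g y" "f differentiable (at x)"
  shows "g differentiable (at x)"
  using assms unfolding differentiable_def by (metis has_derivative_transform_within_open)

lemma Ck_on_cong:
  assumes "open S" "\<And>y. y \<in> S \<Longrightarrow> f y = g y" "Ck_on k S f"
  shows "Ck_on k S g"
  using assms(2,3)
proof (induction k arbitrary: f g)
  case 0
  then show ?case by (simp cong: continuous_on_cong)
next
  case (Suc k)
  have "g differentiable (at x)" if "x \<in> S" for x
    using differentiable_cong_open[OF assms(1) that Suc.prems(1)] Suc.prems(2) that by auto
  moreover have "Ck_on k S (\<lambda>x. fd g x v)" for v
    by (rule Suc.IH[of "\<lambda>x. fd f x v"])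
      (use Suc.prems fd_cong[OF assms(1) _ Suc.prems(1)] in auto)
  ultimately show ?case by simp
qed

lemma Ck_on_Suc_imp: "Ck_on (Suc k) S f \<Longrightarrow> Ck_on k S f"
proof (induction k arbitrary: f)
  case 0
  then show ?case
    by (auto intro!: continuous_at_imp_continuous_on differentiable_imp_continuous_within)
next
  case (Suc k)
  then have "\<forall>x\<in>S. f differentiable (at x)" "\<And>v. Ck_on (Suc k) S (\<lambda>x. fd f x v)"
    by auto
  with Suc.IH show ?case by auto
qed

lemma Ck_on_const [simp]: "Ck_on k S (\<lambda>x. c)"
  by (induction k arbitrary: c) auto

lemma Ck_on_linear:
  assumes "bounded_linear f" shows "Ck_on k S f"
proof (cases k)
  case 0
  then show ?thesis using assms by (simp add: linear_continuous_on)
next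
  case (Suc j)
  have "fd f x = f" for x
    by (rule fd_eqI) (rule bounded_linear_imp_has_derivative[OF assms])
  then show ?thesis
    using Suc bounded_linear_imp_differentiable[OF assms] by simp
qed

lemma Ck_on_add:
  assumes S: "open S" and "Ck_on k S f" "Ck_on k S g"
  shows "Ck_on k S (\<lambda>x. f x + g x)"
  using assms(2,3)
proof (induction k arbitrary: f g)
  case 0
  then show ?case by (simp add: continuous_on_add)
next
  case (Suc k)
  have hd: "((\<lambda>x. f x + g x) has_derivative (\<lambda>v. fd f x v + fd g x v)) (at x)" if "x \<in> S" for x
    using Suc.prems that by (intro has_derivative_add fd_has_derivative) simp_all
  have "Ck_on k S (\<lambda>x. fd f x v + fd g x v)" for v
    using Suc.prems by (intro Suc.IH) simp_all
  then have "Ck_on k S (\<lambda>x. fd (\<lambda>x. f x + g x) x v)" for v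
    by (rule Ck_on_cong[OF S, rotated]) (simp add: fd_eqI[OF hd])
  moreover have "\<forall>x\<in>S. (\<lambda>x. f x + g x) differentiable (at x)"
    using hd unfolding differentiable_def by blast
  ultimately show ?case unfolding Ck_on.simps(2) by blast
qed

lemma Ck_on_bilinear:
  assumes B: "bounded_bilinear B" and S: "open S" and "Ck_on k S f" "Ck_on k S g"
  shows "Ck_on k S (\<lambda>x. B (f x) (g x))"
  using assms(3,4)
proof (induction k arbitrary: f g)
  case 0
  then show ?case by (simp add: bounded_bilinear.continuous_on[OF B])
next
  case (Suc k)
  have hd: "((\<lambda>x. B (f x) (g x)) has_derivative (\<lambda>v. B (f x) (fd g x v) + B (fd f x v) (g x))) (at x)"
    if "x \<in> S" for x
    using Suc.prems that by (intro bounded_bilinear.FDERIV[OF B] fd_has_derivative) simp_all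
  have "Ck_on k S (\<lambda>x. B (f x) (fd g x v) + B (fd f x v) (g x))" for v
  proof (intro Ck_on_add S Suc.IH)
    show "Ck_on k S f" "Ck_on k S g"
      using Suc.prems by (simp_all only: Ck_on_Suc_imp)
    show "Ck_on k S (\<lambda>x. fd f x v)" "Ck_on k S (\<lambda>x. fd g x v)"
      using Suc.prems by simp_all
  qed
  then have "Ck_on k S (\<lambda>x. fd (\<lambda>x. B (f x) (g x)) x v)" for v
    by (rule Ck_on_cong[OF S, rotated]) (simp add: fd_eqI[OF hd])
  moreover have "\<forall>x\<in>S. (\<lambda>x. B (f x) (g x)) differentiable (at x)"
    using hd unfolding differentiable_def by blast
  ultimately show ?case unfolding Ck_on.simps(2) by blast
qed

lemma Ck_on_sum:
  assumes "open S" "\<And>i. i \<in> I \<Longrightarrow> Ck_on k S (f i)"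
  shows "Ck_on k S (\<lambda>x. \<Sum>i\<in>I. f i x)"
  using assms(2) by (induction I rule: infinite_finite_induct) (auto intro!: Ck_on_add assms(1))

lemma linear_euclidean_sum:
  fixes f :: "'b::euclidean_space \<Rightarrow> 'c::real_vector"
  assumes "linear f" shows "f v = (\<Sum>b\<in>Basis. (v \<bullet> b) *\<^sub>R f b)"
proof -
  have "f v = f (\<Sum>b\<in>Basis. (v \<bullet> b) *\<^sub>R b)" by (simp add: euclidean_representation)
  also have "\<dots> = (\<Sum>b\<in>Basis. (v \<bullet> b) *\<^sub>R f b)"
    by (simp add: linear_sum[OF assms] linear_cmul[OF assms])
  finally show ?thesis .
qed

lemma Ck_on_inner: "open S \<Longrightarrow> Ck_on k S f \<Longrightarrow> Ck_on k S (\<lambda>x. f x \<bullet> b)"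
  by (rule Ck_on_bilinear[OF bounded_bilinear_inner]) auto

text \<open>The recursion in \<open>Ck_on\<close> only sees derivatives in a fixed direction. Expanding the inner derivative in
  the basis of the intermediate space writes the derivative of a composition in terms of such
  derivatives, to which the induction hypothesis applies.\<close>

lemma Ck_on_compose:
  fixes f :: "'a::real_normed_vector \<Rightarrow> 'b::euclidean_space"
  assumes S: "open S" and T: "open T" and sub: "f ` S \<subseteq> T" and "Ck_on k S f" "Ck_on k T g"
  shows "Ck_on k S (\<lambda>x. g (f x))"
  using assms(4,5)
proof (induction k arbitrary: g)
  case 0
  then show ?case using sub by (auto intro: continuous_on_compose2)
next
  case (Suc k)
  have fT: "f x \<in> T" if "x \<in> S" for x using sub that by auto
  have df: "f differentiable (at x)" if "x \<in> S" for x using Suc.prems that by auto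
  have dg: "g differentiable (at (f x))" if "x \<in> S" for x using Suc.prems fT[OF that] by auto
  have hd: "((\<lambda>x. g (f x)) has_derivative (\<lambda>v. fd g (f x) (fd f x v))) (at x)" if "x \<in> S" for x
    using diff_chain_at[OF fd_has_derivative[OF df[OF that]] fd_has_derivative[OF dg[OF that]]]
    by (simp add: o_def)
  have "Ck_on k S (\<lambda>x. \<Sum>b\<in>Basis. (fd f x v \<bullet> b) *\<^sub>R fd g (f x) b)" for v
  proof (intro Ck_on_sum S)
    fix b :: 'b
    have "Ck_on k S (\<lambda>x. fd f x v \<bullet> b)"
      using Suc.prems by (intro Ck_on_inner S) auto
    moreover have "Ck_on k S (\<lambda>x. fd g (f x) b)"
      using Suc.prems Ck_on_Suc_imp by (intro Suc.IH) auto
    ultimately show "Ck_on k S (\<lambda>x. (fd f x v \<bullet> b) *\<^sub>R fd g (f x) b)"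
      by (intro Ck_on_bilinear[OF bounded_bilinear_scaleR] S)
  qed
  then have "Ck_on k S (\<lambda>x. fd (\<lambda>x. g (f x)) x v)" for v
    by (rule Ck_on_cong[OF S, rotated])
      (simp add: fd_eqI[OF hd] linear_euclidean_sum[OF linear_frechet_derivative[OF dg], symmetric])
  moreover have "\<forall>x\<in>S. (\<lambda>x. g (f x)) differentiable (at x)"
    using hd unfolding differentiable_def by blast
  ultimately show ?case unfolding Ck_on.simps(2) by blast
qed

lemma smooth_on_cong:
  "open S \<Longrightarrow> smooth_on S f \<Longrightarrow> (\<And>y. y \<in> S \<Longrightarrow> f y = g y) \<Longrightarrow> smooth_on S g"
  unfolding smooth_on_def by (meson Ck_on_cong)

lemma smooth_on_differentiable: "smooth_on S f \<Longrightarrow> x \<in> S \<Longrightarrow> f differentiable (at x)"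
  unfolding smooth_on_def by (metis Ck_on.simps(2))

lemma smooth_on_has_derivative: "smooth_on S f \<Longrightarrow> x \<in> S \<Longrightarrow> (f has_derivative fd f x) (at x)"
  by (simp add: fd_has_derivative smooth_on_differentiable)

lemma smooth_on_fd: "smooth_on S f \<Longrightarrow> smooth_on S (\<lambda>x. fd f x v)"
  unfolding smooth_on_def by (metis Ck_on.simps(2))

lemma smooth_on_const [simp]: "smooth_on S (\<lambda>x. c)"
  by (simp add: smooth_on_def)

lemma smooth_on_linear: "bounded_linear f \<Longrightarrow> smooth_on S f"
  by (simp add: smooth_on_def Ck_on_linear)

lemma smooth_on_add: "open S \<Longrightarrow> smooth_on S f \<Longrightarrow> smooth_on S g \<Longrightarrow> smooth_on S (\<lambda>x. f x + g x)"
  by (simp add: smooth_on_def Ck_on_add)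

lemma smooth_on_sum:
  "open S \<Longrightarrow> (\<And>i. i \<in> I \<Longrightarrow> smooth_on S (f i)) \<Longrightarrow> smooth_on S (\<lambda>x. \<Sum>i\<in>I. f i x)"
  by (simp add: smooth_on_def Ck_on_sum)

lemma smooth_on_scaleR:
  "open S \<Longrightarrow> smooth_on S f \<Longrightarrow> smooth_on S g \<Longrightarrow> smooth_on S (\<lambda>x. f x *\<^sub>R g x)"
  by (simp add: smooth_on_def Ck_on_bilinear[OF bounded_bilinear_scaleR])

lemma smooth_on_mult:
  fixes f g :: "'a::real_normed_vector \<Rightarrow> real"
  shows "open S \<Longrightarrow> smooth_on S f \<Longrightarrow> smooth_on S g \<Longrightarrow> smooth_on S (\<lambda>x. f x * g x)"
  by (simp add: smooth_on_def Ck_on_bilinear[OF bounded_bilinear_mult])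

lemma smooth_on_minus:
  fixes f :: "'a::real_normed_vector \<Rightarrow> real"
  shows "open S \<Longrightarrow> smooth_on S f \<Longrightarrow> smooth_on S (\<lambda>x. - f x)"
  using smooth_on_mult[of S "\<lambda>x. -1" f] by simp

lemma smooth_on_inner: "open S \<Longrightarrow> smooth_on S f \<Longrightarrow> smooth_on S (\<lambda>x. f x \<bullet> b)"
  by (simp add: smooth_on_def Ck_on_inner)

lemma smooth_on_compose:
  fixes f :: "'a::real_normed_vector \<Rightarrow> 'b::euclidean_space"
  shows "open S \<Longrightarrow> open T \<Longrightarrow> smooth_on S f \<Longrightarrow> smooth_on T g \<Longrightarrow> f ` S \<subseteq> T \<Longrightarrow>
    smooth_on S (\<lambda>x. g (f x))"
  by (simp add: smooth_on_def Ck_on_compose)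

lemma fd_compose:
  assumes "f differentiable (at x)" "g differentiable (at (f x))"
  shows "fd (\<lambda>x. g (f x)) x v = fd g (f x) (fd f x v)"
  using diff_chain_at[OF fd_has_derivative[OF assms(1)] fd_has_derivative[OF assms(2)]]
  by (simp add: o_def fd_eqI)

section \<open>Symmetry of second derivatives\<close>

text \<open>The second difference over a parallelogram is symmetric in its two sides. Two applications of the mean
  value theorem turn it into a mixed derivative, in the order in which they are applied.\<close>

lemma second_difference_mean_value:
  fixes f :: "'a::real_normed_vector \<Rightarrow> real"
  assumes C2: "Ck_on 2 S f" and h: "0 < h"
    and inS: "\<And>a b. 0 \<le> a \<Longrightarrow> a \<le> h \<Longrightarrow> 0 \<le> b \<Longrightarrow> b \<le> h \<Longrightarrow> x + a *\<^sub>R u + b *\<^sub>R v \<in> S"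
  obtains a b where "0 < a" "a < h" "0 < b" "b < h"
    "f (x + h *\<^sub>R u + h *\<^sub>R v) - f (x + h *\<^sub>R u) - f (x + h *\<^sub>R v) + f x
      = h * h * fd (\<lambda>y. fd f y u) (x + a *\<^sub>R u + b *\<^sub>R v) v"
proof -
  have C2': "\<And>y. y \<in> S \<Longrightarrow> f differentiable (at y)"
    "\<And>y w. y \<in> S \<Longrightarrow> (\<lambda>y. fd f y w) differentiable (at y)"
    using C2 by (auto simp: numeral_2_eq_2)
  have hd: "((\<lambda>s. f (p + s *\<^sub>R w)) has_real_derivative fd f (p + s *\<^sub>R w) w) (at s)"
    if "p + s *\<^sub>R w \<in> S" for p w s
  proof -
    have "((\<lambda>s. p + s *\<^sub>R w) has_derivative (\<lambda>k. k *\<^sub>R w)) (at s)"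
      by (auto intro!: derivative_eq_intros)
    from diff_chain_at[OF this fd_has_derivative[OF C2'(1)[OF that]]]
    show ?thesis
      using linear_frechet_derivative[OF C2'(1)[OF that]]
      by (simp add: o_def has_field_derivative_def linear_cmul mult_commute_abs)
  qed
  have hd2: "((\<lambda>s. fd f (p + s *\<^sub>R w) u) has_real_derivative fd (\<lambda>y. fd f y u) (p + s *\<^sub>R w) w) (at s)"
    if "p + s *\<^sub>R w \<in> S" for p w s
  proof -
    have "((\<lambda>s. p + s *\<^sub>R w) has_derivative (\<lambda>k. k *\<^sub>R w)) (at s)"
      by (auto intro!: derivative_eq_intros)
    from diff_chain_at[OF this fd_has_derivative[OF C2'(2)[OF that]]]
    show ?thesis
      using linear_frechet_derivative[OF C2'(2)[OF that]]
      by (simp add: o_def has_field_derivative_def linear_cmul mult_commute_abs)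
  qed
  let ?\<phi> = "\<lambda>s. f ((x + h *\<^sub>R v) + s *\<^sub>R u) - f (x + s *\<^sub>R u)"
  have "\<exists>a. 0 < a \<and> a < h \<and> ?\<phi> h - ?\<phi> 0 =
     (h - 0) * (fd f ((x + h *\<^sub>R v) + a *\<^sub>R u) u - fd f (x + a *\<^sub>R u) u)"
  proof (rule MVT2[OF h])
    fix s assume s: "0 \<le> s" "s \<le> h"
    show "(?\<phi> has_real_derivative fd f ((x + h *\<^sub>R v) + s *\<^sub>R u) u - fd f (x + s *\<^sub>R u) u) (at s)"
      using inS[of s h] inS[of s 0] s h
      by (intro DERIV_diff hd) (auto simp: algebra_simps)
  qed
  then obtain a where a: "0 < a" "a < h" "?\<phi> h - ?\<phi> 0 =
      h * (fd f ((x + h *\<^sub>R v) + a *\<^sub>R u) u - fd f (x + a *\<^sub>R u) u)" by auto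
  have "\<exists>b. 0 < b \<and> b < h \<and> fd f ((x + a *\<^sub>R u) + h *\<^sub>R v) u - fd f ((x + a *\<^sub>R u) + 0 *\<^sub>R v) u =
     (h - 0) * fd (\<lambda>y. fd f y u) ((x + a *\<^sub>R u) + b *\<^sub>R v) v"
    by (rule MVT2[OF h]) (use inS a h in \<open>auto intro!: hd2\<close>)
  then obtain b where b: "0 < b" "b < h" "fd f ((x + a *\<^sub>R u) + h *\<^sub>R v) u - fd f (x + a *\<^sub>R u) u =
      h * fd (\<lambda>y. fd f y u) (x + a *\<^sub>R u + b *\<^sub>R v) v" by auto
  have swap: "(x + h *\<^sub>R v) + a *\<^sub>R u = (x + a *\<^sub>R u) + h *\<^sub>R v" "(x + h *\<^sub>R v) + h *\<^sub>R u = x + h *\<^sub>R u + h *\<^sub>R v"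
    by (auto simp: algebra_simps)
  have "f (x + h *\<^sub>R u + h *\<^sub>R v) - f (x + h *\<^sub>R u) - f (x + h *\<^sub>R v) + f x
      = h * (h * fd (\<lambda>y. fd f y u) (x + a *\<^sub>R u + b *\<^sub>R v) v)"
    using a(3) unfolding swap b(3) by simp
  with a b that show ?thesis by (simp add: mult.assoc)
qed

text \<open>If the two mixed derivatives differed at \<open>x\<close>, then by continuity their values at any two points of a
  small parallelogram at \<open>x\<close> would differ, although the second difference is a value of both.\<close>

lemma second_derivative_symmetric_real:
  fixes f :: "'a::real_normed_vector \<Rightarrow> real"
  assumes S: "open S" and x: "x \<in> S" and C2: "Ck_on 2 S f"
  shows "fd (\<lambda>y. fd f y u) x v = fd (\<lambda>y. fd f y v) x u"
proof (rule ccontr)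
  let ?A = "\<lambda>y. fd (\<lambda>y. fd f y u) y v" and ?B = "\<lambda>y. fd (\<lambda>y. fd f y v) y u"
  assume ne: "?A x \<noteq> ?B x"
  define e where "e = \<bar>?A x - ?B x\<bar> / 2"
  have e: "e > 0" using ne by (simp add: e_def)
  have cA: "isCont ?A x" and cB: "isCont ?B x"
    using C2 x S by (auto simp: numeral_2_eq_2 continuous_on_eq_continuous_at)
  obtain r0 where r0: "r0 > 0" "ball x r0 \<subseteq> S" using S x by (meson openE)
  obtain r1 where r1: "r1 > 0" "\<And>y. dist y x < r1 \<Longrightarrow> dist (?A y) (?A x) < e"
    using cA e unfolding continuous_at_eps_delta by metis
  obtain r2 where r2: "r2 > 0" "\<And>y. dist y x < r2 \<Longrightarrow> dist (?B y) (?B x) < e"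
    using cB e unfolding continuous_at_eps_delta by metis
  define r where "r = min r0 (min r1 r2)"
  define h where "h = r / (2 * (norm u + norm v + 1))"
  have r: "r > 0" using r0 r1 r2 by (simp add: r_def)
  have pos: "norm u + norm v + 1 > 0" by (simp add: add_nonneg_pos)
  have h: "h > 0" using r pos by (simp add: h_def)
  have near: "dist (x + a *\<^sub>R u + b *\<^sub>R v) x < r" if "0 \<le> a" "a \<le> h" "0 \<le> b" "b \<le> h" for a b
  proof -
    have "dist (x + a *\<^sub>R u + b *\<^sub>R v) x = norm (a *\<^sub>R u + b *\<^sub>R v)" by (simp add: dist_norm)
    also have "\<dots> \<le> a * norm u + b * norm v" using that by (metis abs_of_nonneg norm_scaleR norm_triangle_ineq)
    also have "\<dots> \<le> h * norm u + h * norm v" using that by (intro add_mono mult_right_mono) auto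
    also have "\<dots> \<le> h * (norm u + norm v + 1)" using h by (simp add: algebra_simps)
    also have "\<dots> = r / 2" unfolding h_def times_divide_eq_left
      using pos by (subst mult.commute[of 2], subst frac_eq_eq) auto
    finally show ?thesis using r by simp
  qed
  have inS: "x + a *\<^sub>R u + b *\<^sub>R v \<in> S" if "0 \<le> a" "a \<le> h" "0 \<le> b" "b \<le> h" for a b
    using near[OF that] r0(2) by (auto simp: r_def dist_commute)
  obtain a b where ab: "0 < a" "a < h" "0 < b" "b < h"
    "f (x + h *\<^sub>R u + h *\<^sub>R v) - f (x + h *\<^sub>R u) - f (x + h *\<^sub>R v) + f x = h * h * ?A (x + a *\<^sub>R u + b *\<^sub>R v)"
    using second_difference_mean_value[OF C2 h inS] by blast
  have inS': "x + a *\<^sub>R v + b *\<^sub>R u \<in> S" if "0 \<le> a" "a \<le> h" "0 \<le> b" "b \<le> h" for a b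
    using inS[of b a] that by (simp add: algebra_simps)
  obtain a' b' where ab': "0 < a'" "a' < h" "0 < b'" "b' < h"
    "f (x + h *\<^sub>R v + h *\<^sub>R u) - f (x + h *\<^sub>R v) - f (x + h *\<^sub>R u) + f x = h * h * ?B (x + a' *\<^sub>R v + b' *\<^sub>R u)"
    using second_difference_mean_value[OF C2 h inS'] by blast
  have swap: "x + h *\<^sub>R v + h *\<^sub>R u = x + h *\<^sub>R u + h *\<^sub>R v" "x + a' *\<^sub>R v + b' *\<^sub>R u = x + b' *\<^sub>R u + a' *\<^sub>R v"
    by (auto simp: algebra_simps)
  have "h * h * ?A (x + a *\<^sub>R u + b *\<^sub>R v) = h * h * ?B (x + b' *\<^sub>R u + a' *\<^sub>R v)"
    using ab(5) ab'(5) unfolding swap by linarith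
  then have "?A (x + a *\<^sub>R u + b *\<^sub>R v) = ?B (x + b' *\<^sub>R u + a' *\<^sub>R v)" using h by simp
  moreover have "dist (?A (x + a *\<^sub>R u + b *\<^sub>R v)) (?A x) < e"
    using near[of a b] ab by (intro r1) (auto simp: r_def)
  moreover have "dist (?B (x + b' *\<^sub>R u + a' *\<^sub>R v)) (?B x) < e"
    using near[of b' a'] ab' by (intro r2) (auto simp: r_def)
  ultimately have "dist (?A x) (?B x) < \<bar>?A x - ?B x\<bar>"
    unfolding e_def using dist_triangle_half_r[of "?A (x + a *\<^sub>R u + b *\<^sub>R v)" "?A x" "\<bar>?A x - ?B x\<bar>" "?B x"]
    by simp
  then show False by (simp add: dist_real_def)
qed

lemma second_derivative_symmetric:
  fixes f :: "'a::real_normed_vector \<Rightarrow> 'b::euclidean_space"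
  assumes S: "open S" and x: "x \<in> S" and sm: "smooth_on S f"
  shows "fd (\<lambda>y. fd f y u) x v = fd (\<lambda>y. fd f y v) x u"
proof (rule euclidean_eqI)
  fix b :: 'b assume b: "b \<in> Basis"
  have inner: "fd (\<lambda>z. p z \<bullet> b) y w = fd p y w \<bullet> b" if "p differentiable (at y)" for p :: "'a \<Rightarrow> 'b" and y w
    using fd_compose[OF that, of "\<lambda>z. z \<bullet> b" w] bounded_linear_inner_left[of b]
    by (simp add: bounded_linear_imp_differentiable fd_eqI[OF bounded_linear_imp_has_derivative])
  have second: "fd (\<lambda>y. fd (\<lambda>z. f z \<bullet> b) y p) x q = fd (\<lambda>y. fd f y p) x q \<bullet> b" for p q
  proof -
    have "fd (\<lambda>y. fd (\<lambda>z. f z \<bullet> b) y p) x q = fd (\<lambda>y. fd f y p \<bullet> b) x q"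
      using fd_cong[OF S x, of "\<lambda>y. fd (\<lambda>z. f z \<bullet> b) y p" "\<lambda>y. fd f y p \<bullet> b"] inner smooth_on_differentiable[OF sm]
      by simp
    also have "\<dots> = fd (\<lambda>y. fd f y p) x q \<bullet> b"
      by (rule inner) (rule smooth_on_differentiable[OF smooth_on_fd[OF sm] x])
    finally show ?thesis .
  qed
  have "Ck_on 2 S (\<lambda>z. f z \<bullet> b)" using smooth_on_inner[OF S sm] by (simp add: smooth_on_def)
  from second_derivative_symmetric_real[OF S x this, of u v]
  show "fd (\<lambda>y. fd f y u) x v \<bullet> b = fd (\<lambda>y. fd f y v) x u \<bullet> b"
    unfolding second .
qed

section \<open>Inner products and orthonormal bases\<close>

lemma bilinearI:
  assumes "\<And>x y z. h (x + y) z = h x z + h y z" "\<And>c x z. h (c *\<^sub>R x) z = c *\<^sub>R h x z"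
    "\<And>x y z. h z (x + y) = h z x + h z y" "\<And>c x z. h z (c *\<^sub>R x) = c *\<^sub>R h z x"
  shows "bilinear h"
  unfolding bilinear_def using assms by (auto intro!: linearI)

definition inner_form :: "('e::euclidean_space \<Rightarrow> 'e \<Rightarrow> real) \<Rightarrow> bool" where
  "inner_form b \<longleftrightarrow> bilinear b \<and> (\<forall>u v. b u v = b v u) \<and> (\<forall>u. u \<noteq> 0 \<longrightarrow> 0 < b u u)"

definition orthonormal_set :: "('e::euclidean_space \<Rightarrow> 'e \<Rightarrow> real) \<Rightarrow> 'e set \<Rightarrow> bool" where
  "orthonormal_set b B \<longleftrightarrow> finite B \<and> (\<forall>e\<in>B. \<forall>f\<in>B. b e f = (if e = f then 1 else 0))"

lemma orthonormal_basis_iff: "orthonormal_basis b B \<longleftrightarrow> orthonormal_set b B \<and> span B = UNIV"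
  unfolding orthonormal_basis_def orthonormal_set_def by auto

lemma bilinear_lsum: "bilinear b \<Longrightarrow> b (\<Sum>i\<in>I. c i *\<^sub>R f i) w = (\<Sum>i\<in>I. c i *\<^sub>R b (f i) w)"
  by (simp add: bilinear_def linear_sum[of "\<lambda>x. b x w"] linear_cmul[of "\<lambda>x. b x w"])

lemma inner_form_eqI:
  assumes "inner_form b" "\<And>w. b u w = b v w" shows "u = v"
proof (rule ccontr)
  assume "u \<noteq> v"
  then have "0 < b (u - v) (u - v)" using assms(1) by (simp add: inner_form_def)
  moreover have "b (u - v) (u - v) = 0"
    using assms(1) assms(2)[of "u - v"] by (simp add: inner_form_def bilinear_lsub[of b])
  ultimately show False by simp
qed

lemma orthonormal_coefficient:
  assumes "bilinear b" "orthonormal_set b B" "f \<in> B"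
  shows "b (\<Sum>e\<in>B. c e *\<^sub>R e) f = c f"
proof -
  have "b (\<Sum>e\<in>B. c e *\<^sub>R e) f = (\<Sum>e\<in>B. c e * b e f)"
    using bilinear_lsum[OF assms(1), of c "\<lambda>e. e"] by simp
  also have "\<dots> = (\<Sum>e\<in>B. if e = f then c e else 0)"
    using assms by (intro sum.cong) (auto simp: orthonormal_set_def)
  also have "\<dots> = c f" using assms by (simp add: orthonormal_set_def)
  finally show ?thesis .
qed

lemma orthonormal_expansion:
  assumes "bilinear b" "orthonormal_set b B" "v \<in> span B"
  shows "v = (\<Sum>e\<in>B. b v e *\<^sub>R e)"
proof -
  obtain c where v: "v = (\<Sum>e\<in>B. c e *\<^sub>R e)"
    using assms by (auto simp: span_finite orthonormal_set_def)
  then have "b v e = c e" if "e \<in> B" for e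
    using orthonormal_coefficient[OF assms(1,2) that] by simp
  then show ?thesis using v by simp
qed

lemma orthonormal_independent:
  assumes "bilinear b" "orthonormal_set b B" shows "independent B"
proof -
  have fin: "finite B" using assms by (simp add: orthonormal_set_def)
  have "c f = 0" if "(\<Sum>e\<in>B. c e *\<^sub>R e) = 0" "f \<in> B" for c f
    using orthonormal_coefficient[OF assms that(2), of c] that(1) bilinear_lzero[OF assms(1)] by simp
  then show ?thesis using dependent_finite[OF fin] by blast
qed

lemma orthonormal_basisI:
  fixes b :: "'e::euclidean_space \<Rightarrow> 'e \<Rightarrow> real"
  assumes "bilinear b" "orthonormal_set b B" "card B = DIM('e)"
  shows "orthonormal_basis b B"
proof -
  have "UNIV \<subseteq> span B"
    using assms by (intro card_ge_dim_independent orthonormal_independent) auto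
  then show ?thesis using assms by (auto simp: orthonormal_basis_iff)
qed

lemma orthonormal_basis_card:
  fixes b :: "'e::euclidean_space \<Rightarrow> 'e \<Rightarrow> real"
  assumes "bilinear b" "orthonormal_basis b B"
  shows "card B = DIM('e)"
  using assms orthonormal_independent[of b B] dim_eq_card[of B UNIV]
  by (simp add: orthonormal_basis_iff)

text \<open>An orthonormal set of maximal cardinality spans, because the normalised component orthogonal to it
  of a vector outside its span would enlarge it.\<close>

lemma orthonormal_basis_exists:
  fixes b :: "'e::euclidean_space \<Rightarrow> 'e \<Rightarrow> real"
  assumes b: "inner_form b"
  shows "\<exists>B. orthonormal_basis b B"
proof -
  have bil: "bilinear b" using b by (simp add: inner_form_def)
  have sym: "b u v = b v u" for u v using b by (simp add: inner_form_def)
  have "orthonormal_set b {}" by (simp add: orthonormal_set_def)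
  moreover have "\<forall>B. orthonormal_set b B \<longrightarrow> card B < Suc DIM('e)"
    using orthonormal_independent[OF bil] independent_bound by (auto simp: less_Suc_eq_le)
  ultimately have "\<exists>B. orthonormal_set b B \<and> (\<forall>C. orthonormal_set b C \<longrightarrow> card C \<le> card B)"
    by (rule Lattices_Big.ex_has_greatest_nat)
  then obtain B where B: "orthonormal_set b B" "\<And>C. orthonormal_set b C \<Longrightarrow> card C \<le> card B"
    by blast
  have fin: "finite B" using B(1) by (simp add: orthonormal_set_def)
  have "span B = UNIV"
  proof (rule ccontr)
    assume "span B \<noteq> UNIV"
    then obtain v where v: "v \<notin> span B" by auto
    define w where "w = v - (\<Sum>e\<in>B. b v e *\<^sub>R e)"
    have "(\<Sum>e\<in>B. b v e *\<^sub>R e) \<in> span B" by (intro span_sum span_scale span_base)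
    then have "w \<noteq> 0" using v w_def by auto
    then have pos: "b w w > 0" using b by (simp add: inner_form_def)
    have perp: "b w f = 0" if "f \<in> B" for f
      using orthonormal_coefficient[OF bil B(1) that, of "b v"] by (simp add: w_def bilinear_lsub[OF bil])
    define u where "u = (1 / sqrt (b w w)) *\<^sub>R w"
    have u1: "b u u = 1" using pos by (simp add: u_def bilinear_lmul[OF bil] bilinear_rmul[OF bil])
    have uf: "b u f = 0" "b f u = 0" if "f \<in> B" for f
      using perp[OF that] sym by (simp_all add: u_def bilinear_lmul[OF bil] bilinear_rmul[OF bil])
    have "u \<notin> B" using u1 uf by force
    moreover have "orthonormal_set b (insert u B)"
      using B(1) u1 uf \<open>u \<notin> B\<close> by (auto simp: orthonormal_set_def)
    ultimately show False using B(2)[of "insert u B"] fin by simp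
  qed
  then show ?thesis using B(1) by (auto simp: orthonormal_basis_iff)
qed

lemma orthonormal_basis_inner:
  assumes "bilinear b" "orthonormal_basis b B" "\<And>u v. b u v = b v u"
  shows "b v w = (\<Sum>e\<in>B. b v e * b w e)"
proof -
  have "b v w = b (\<Sum>e\<in>B. b v e *\<^sub>R e) w"
    using orthonormal_expansion[OF assms(1), of B v] assms(2) by (simp add: orthonormal_basis_iff)
  also have "\<dots> = (\<Sum>e\<in>B. b v e * b w e)"
    using bilinear_lsum[OF assms(1), of "b v" "\<lambda>e. e" B] assms(3) by simp
  finally show ?thesis .
qed

lemma inner_form_represents:
  assumes b: "inner_form b" and "linear \<phi>"
  shows "\<exists>z. \<forall>w. b z w = \<phi> w"
proof -
  have bil: "bilinear b" and sym: "\<And>u v. b u v = b v u" using b by (auto simp: inner_form_def)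
  obtain B where B: "orthonormal_basis b B" using orthonormal_basis_exists[OF b] by blast
  have "b (\<Sum>e\<in>B. \<phi> e *\<^sub>R e) w = \<phi> w" for w
  proof -
    have "\<phi> w = \<phi> (\<Sum>e\<in>B. b w e *\<^sub>R e)"
      using orthonormal_expansion[OF bil, of B w] B by (simp add: orthonormal_basis_iff)
    also have "\<dots> = (\<Sum>e\<in>B. b w e * \<phi> e)"
      using assms(2) by (simp add: linear_sum linear_cmul)
    finally show ?thesis
      using bilinear_lsum[OF bil, of \<phi> "\<lambda>e. e" B w] sym by (simp add: mult.commute)
  qed
  then show ?thesis by blast
qed

section \<open>Fields of linear and bilinear maps\<close>

lemma fd_add:
  "f differentiable (at x) \<Longrightarrow> g differentiable (at x) \<Longrightarrow> fd (\<lambda>y. f y + g y) x u = fd f x u + fd g x u"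
  by (simp add: fd_eqI[OF has_derivative_add[OF fd_has_derivative fd_has_derivative]])

lemma fd_diff:
  "f differentiable (at x) \<Longrightarrow> g differentiable (at x) \<Longrightarrow> fd (\<lambda>y. f y - g y) x u = fd f x u - fd g x u"
  by (simp add: fd_eqI[OF has_derivative_diff[OF fd_has_derivative fd_has_derivative]])

lemma fd_minus: "f differentiable (at x) \<Longrightarrow> fd (\<lambda>y. - f y) x u = - fd f x u"
  by (simp add: fd_eqI[OF has_derivative_minus[OF fd_has_derivative]])

lemma fd_scaleR_right: "f differentiable (at x) \<Longrightarrow> fd (\<lambda>y. c *\<^sub>R f y) x u = c *\<^sub>R fd f x u"
  by (simp add: fd_eqI[OF has_derivative_scaleR_right[OF fd_has_derivative]])

lemma fd_linear_field:
  assumes S: "open S" "x \<in> S" and lin: "\<And>y. y \<in> S \<Longrightarrow> linear (A y)"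
    and diff: "\<And>v. (\<lambda>y. A y v) differentiable (at x)"
  shows "linear (\<lambda>v. fd (\<lambda>y. A y v) x u)"
proof (rule linearI)
  fix v w
  have "fd (\<lambda>y. A y (v + w)) x u = fd (\<lambda>y. A y v + A y w) x u"
    using fd_cong[OF S, of "\<lambda>y. A y (v + w)" "\<lambda>y. A y v + A y w"] linear_add[OF lin] by simp
  then show "fd (\<lambda>y. A y (v + w)) x u = fd (\<lambda>y. A y v) x u + fd (\<lambda>y. A y w) x u"
    by (simp add: fd_add diff)
next
  fix c v
  have "fd (\<lambda>y. A y (c *\<^sub>R v)) x u = fd (\<lambda>y. c *\<^sub>R A y v) x u"
    using fd_cong[OF S, of "\<lambda>y. A y (c *\<^sub>R v)" "\<lambda>y. c *\<^sub>R A y v"] linear_cmul[OF lin] by simp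
  then show "fd (\<lambda>y. A y (c *\<^sub>R v)) x u = c *\<^sub>R fd (\<lambda>y. A y v) x u"
    by (simp add: fd_scaleR_right diff)
qed

lemma fd_bilinear_field:
  assumes "open S" "x \<in> S" and "\<And>y. y \<in> S \<Longrightarrow> bilinear (G y)"
    and "\<And>v w. (\<lambda>y. G y v w) differentiable (at x)"
  shows "bilinear (\<lambda>v w. fd (\<lambda>y. G y v w) x u)"
  unfolding bilinear_def
  using fd_linear_field[of S x "\<lambda>y v. G y v w" u for w] fd_linear_field[of S x "\<lambda>y. G y v" u for v] assms
  by (auto simp: bilinear_def)

text \<open>The product rule for a field of linear maps applied to a vector field. Only the components of \<open>A\<close> are
  known to be differentiable, so the vector field is expanded in the standard basis.\<close>

lemma has_derivative_linear_field:
  fixes A :: "'a::real_normed_vector \<Rightarrow> 'b::euclidean_space \<Rightarrow> 'c::real_normed_vector"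
  assumes S: "open S" "x \<in> S" and lin: "\<And>y. y \<in> S \<Longrightarrow> linear (A y)"
    and diff: "\<And>v. (\<lambda>y. A y v) differentiable (at x)" and a: "a differentiable (at x)"
  shows "((\<lambda>y. A y (a y)) has_derivative (\<lambda>u. fd (\<lambda>y. A y (a x)) x u + A x (fd a x u))) (at x)"
proof -
  have "((\<lambda>y. \<Sum>b\<in>Basis. (a y \<bullet> b) *\<^sub>R A y b) has_derivative
      (\<lambda>u. \<Sum>b\<in>Basis. (a x \<bullet> b) *\<^sub>R fd (\<lambda>y. A y b) x u + (fd a x u \<bullet> b) *\<^sub>R A x b)) (at x)"
    by (intro has_derivative_sum has_derivative_scaleR has_derivative_inner_left fd_has_derivative a diff)
  then have "((\<lambda>y. A y (a y)) has_derivative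
      (\<lambda>u. \<Sum>b\<in>Basis. (a x \<bullet> b) *\<^sub>R fd (\<lambda>y. A y b) x u + (fd a x u \<bullet> b) *\<^sub>R A x b)) (at x)"
    by (rule has_derivative_transform_within_open[OF _ S]) (rule linear_euclidean_sum[OF lin, symmetric])
  moreover have "(\<Sum>b\<in>Basis. (a x \<bullet> b) *\<^sub>R fd (\<lambda>y. A y b) x u + (fd a x u \<bullet> b) *\<^sub>R A x b)
    = fd (\<lambda>y. A y (a x)) x u + A x (fd a x u)" for u
    using linear_euclidean_sum[OF fd_linear_field[OF S lin diff, where u=u], where v="a x"]
      linear_euclidean_sum[OF lin[OF S(2)], of "fd a x u"]
    by (simp add: sum.distrib)
  ultimately show ?thesis by simp
qed

lemma has_derivative_bilinear_field:
  fixes G :: "'a::real_normed_vector \<Rightarrow> 'b::euclidean_space \<Rightarrow> 'd::euclidean_space \<Rightarrow> 'c::real_normed_vector"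
  assumes S: "open S" "x \<in> S" and bil: "\<And>y. y \<in> S \<Longrightarrow> bilinear (G y)"
    and diff: "\<And>v w. (\<lambda>y. G y v w) differentiable (at x)"
    and a: "a differentiable (at x)" and b: "b differentiable (at x)"
  shows "((\<lambda>y. G y (a y) (b y)) has_derivative
    (\<lambda>u. fd (\<lambda>y. G y (a x) (b x)) x u + G x (fd a x u) (b x) + G x (a x) (fd b x u))) (at x)"
proof -
  have l: "((\<lambda>y. G y (a y) w) has_derivative (\<lambda>u. fd (\<lambda>y. G y (a x) w) x u + G x (fd a x u) w)) (at x)" for w
    using bil by (intro has_derivative_linear_field[OF S _ diff a]) (auto simp: bilinear_def)
  have "((\<lambda>y. G y (a y) (b y)) has_derivative
     (\<lambda>u. fd (\<lambda>y. G y (a y) (b x)) x u + G x (a x) (fd b x u))) (at x)"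
  proof (intro has_derivative_linear_field[OF S _ _ b])
    show "(\<lambda>y. G y (a y) v) differentiable (at x)" for v
      using l unfolding differentiable_def by blast
  qed (use bil in \<open>simp add: bilinear_def\<close>)
  then show ?thesis unfolding fd_eqI[OF l] .
qed

lemma smooth_on_linear_field:
  fixes A :: "'a::real_normed_vector \<Rightarrow> 'b::euclidean_space \<Rightarrow> 'c::real_normed_vector"
  assumes S: "open S" and lin: "\<And>y. y \<in> S \<Longrightarrow> linear (A y)"
    and sm: "\<And>v. smooth_on S (\<lambda>y. A y v)" and a: "smooth_on S a"
  shows "smooth_on S (\<lambda>y. A y (a y))"
proof (rule smooth_on_cong[OF S])
  show "smooth_on S (\<lambda>y. \<Sum>b\<in>Basis. (a y \<bullet> b) *\<^sub>R A y b)"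
    by (intro smooth_on_sum smooth_on_scaleR smooth_on_inner S a sm)
qed (rule linear_euclidean_sum[OF lin, symmetric])

lemma smooth_on_bilinear_field:
  fixes G :: "'a::real_normed_vector \<Rightarrow> 'b::euclidean_space \<Rightarrow> 'd::euclidean_space \<Rightarrow> 'c::real_normed_vector"
  assumes S: "open S" and bil: "\<And>y. y \<in> S \<Longrightarrow> bilinear (G y)"
    and sm: "\<And>v w. smooth_on S (\<lambda>y. G y v w)" and ab: "smooth_on S a" "smooth_on S b"
  shows "smooth_on S (\<lambda>y. G y (a y) (b y))"
proof -
  have "smooth_on S (\<lambda>y. G y (a y) w)" for w
    by (rule smooth_on_linear_field[OF S, of "\<lambda>y v. G y v w"])
      (use bil sm ab in \<open>auto simp: bilinear_def\<close>)
  then show ?thesis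
    using smooth_on_linear_field[OF S, of "\<lambda>y. G y (a y)", OF _ _ ab(2)] bil
    by (simp add: bilinear_def)
qed

section \<open>The Levi-Civita connection\<close>

text \<open>Here \<open>D u v w\<close> plays the role of the derivative \<open>u\<langle>v, w\<rangle>\<close>. Symmetry and metricity together determine
  \<open>2\<langle>\<Gamma> u v, w\<rangle>\<close> by the Koszul formula.\<close>

lemma levi_civita_unique:
  assumes b: "inner_form b"
    and sym: "\<And>u v. \<Gamma> u v = \<Gamma> v u" "\<And>u v. \<Gamma>' u v = \<Gamma>' v u"
    and comp: "\<And>u v w. D u v w = b (\<Gamma> u v) w + b v (\<Gamma> u w)"
      "\<And>u v w. D u v w = b (\<Gamma>' u v) w + b v (\<Gamma>' u w)"
  shows "\<Gamma> = \<Gamma>'"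
proof (intro ext inner_form_eqI[OF b])
  fix u v w
  have s: "b p q = b q p" for p q using b by (simp add: inner_form_def)
  have "2 * b (\<Gamma> u v) w = D u v w + D v u w - D w u v"
    using comp(1)[of u v w] comp(1)[of v u w] comp(1)[of w u v] sym(1) s by simp
  moreover have "2 * b (\<Gamma>' u v) w = D u v w + D v u w - D w u v"
    using comp(2)[of u v w] comp(2)[of v u w] comp(2)[of w u v] sym(2) s by simp
  ultimately show "b (\<Gamma> u v) w = b (\<Gamma>' u v) w" by simp
qed

text \<open>The right-hand side of the Koszul formula is linear in \<open>w\<close>, hence represented by a vector, which is taken
  as \<open>\<Gamma> u v\<close>.\<close>

lemma levi_civita_exists:
  fixes b :: "'e::euclidean_space \<Rightarrow> 'e \<Rightarrow> real"
  assumes b: "inner_form b"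
    and D1: "\<And>v w. linear (\<lambda>u. D u v w)" and D2: "\<And>u. bilinear (D u)" and Ds: "\<And>u v w. D u v w = D u w v"
  shows "\<exists>\<Gamma>. bilinear \<Gamma> \<and> (\<forall>u v. \<Gamma> u v = \<Gamma> v u) \<and> (\<forall>u v w. D u v w = b (\<Gamma> u v) w + b v (\<Gamma> u w))"
proof -
  have bil: "bilinear b" and s: "\<And>u v. b u v = b v u" using b by (auto simp: inner_form_def)
  define k where "k u v w = (D u v w + D v u w - D w u v) / 2" for u v w
  note D_lin = linear_add[OF D1] linear_cmul[OF D1] bilinear_ladd[OF D2] bilinear_radd[OF D2]
    bilinear_lmul[OF D2] bilinear_rmul[OF D2]
  have "linear (k u v)" for u v
    by (rule linearI) (simp_all add: k_def D_lin field_simps)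
  then have "\<forall>u v. \<exists>z. \<forall>w. b z w = k u v w"
    using inner_form_represents[OF b] by blast
  then obtain \<Gamma> where \<Gamma>: "\<And>u v w. b (\<Gamma> u v) w = k u v w" by metis
  have "bilinear \<Gamma>"
    by (intro bilinearI inner_form_eqI[OF b])
      (simp_all add: \<Gamma> bilinear_ladd[OF bil] bilinear_lmul[OF bil] k_def D_lin field_simps)
  moreover have "\<Gamma> u v = \<Gamma> v u" for u v
    by (rule inner_form_eqI[OF b]) (simp add: \<Gamma> k_def Ds[of _ u v])
  moreover have "D u v w = b (\<Gamma> u v) w + b v (\<Gamma> u w)" for u v w
    unfolding s[of v] \<Gamma> k_def using Ds[of u v w] Ds[of v u w] Ds[of w u v] by (simp add: field_simps)
  ultimately show ?thesis by blast
qed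

text \<open>Existence and uniqueness make the definite description in \<open>christoffel\<close> denote the connection.\<close>

lemma christoffel_eqs:
  fixes g :: "('m, 'e::euclidean_space) bilinear_field"
  assumes S: "open S" "x \<in> S" and bil: "\<And>y. y \<in> S \<Longrightarrow> bilinear (g c y)"
    and sym: "\<And>y u v. y \<in> S \<Longrightarrow> g c y u v = g c y v u"
    and pos: "\<And>u. u \<noteq> 0 \<Longrightarrow> 0 < g c x u u"
    and diff: "\<And>v w. (\<lambda>y. g c y v w) differentiable (at x)"
  shows "bilinear (christoffel g c x)"
    and "christoffel g c x u v = christoffel g c x v u"
    and "fd (\<lambda>y. g c y v w) x u = g c x (christoffel g c x u v) w + g c x v (christoffel g c x u w)"
proof -
  have b: "inner_form (g c x)" using assms by (auto simp: inner_form_def)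
  let ?P = "\<lambda>\<Gamma>. bilinear \<Gamma> \<and> (\<forall>u v. \<Gamma> u v = \<Gamma> v u) \<and>
     (\<forall>u v w. fd (\<lambda>y. g c y v w) x u = g c x (\<Gamma> u v) w + g c x v (\<Gamma> u w))"
  have "\<exists>\<Gamma>. ?P \<Gamma>"
  proof (rule levi_civita_exists[OF b, of "\<lambda>u v w. fd (\<lambda>y. g c y v w) x u"])
    show "linear (\<lambda>u. fd (\<lambda>y. g c y v w) x u)" for v w
      by (rule linear_frechet_derivative[OF diff])
    show "bilinear (\<lambda>v w. fd (\<lambda>y. g c y v w) x u)" for u
      by (rule fd_bilinear_field[OF S bil diff])
    show "fd (\<lambda>y. g c y v w) x u = fd (\<lambda>y. g c y w v) x u" for u v w
      using fd_cong[OF S, of "\<lambda>y. g c y v w" "\<lambda>y. g c y w v"] sym by simp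
  qed
  moreover have "\<Gamma> = \<Gamma>'" if "?P \<Gamma>" "?P \<Gamma>'" for \<Gamma> \<Gamma>'
    by (rule levi_civita_unique[OF b, of \<Gamma> \<Gamma>' "\<lambda>u v w. fd (\<lambda>y. g c y v w) x u"])
      (use that in blast)+
  ultimately have "\<exists>!\<Gamma>. ?P \<Gamma>" by (rule ex_ex1I)
  from theI'[OF this] have "?P (christoffel g c x)"
    unfolding christoffel_def .
  then show "bilinear (christoffel g c x)"
    and "christoffel g c x u v = christoffel g c x v u"
    and "fd (\<lambda>y. g c y v w) x u = g c x (christoffel g c x u v) w + g c x v (christoffel g c x u w)"
    by simp_all
qed

section \<open>Exterior derivatives of one- and two-forms\<close>

text \<open>Forms in a fixed chart, evaluated on constant vector fields; these commute, so no bracket terms appear.\<close>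

definition ext_deriv_1 :: "('a::real_normed_vector \<Rightarrow> 'a \<Rightarrow> real) \<Rightarrow> 'a \<Rightarrow> 'a \<Rightarrow> 'a \<Rightarrow> real" where
  "ext_deriv_1 \<theta> x u v = fd (\<lambda>y. \<theta> y v) x u - fd (\<lambda>y. \<theta> y u) x v"

definition ext_deriv_2 :: "('a::real_normed_vector \<Rightarrow> 'a \<Rightarrow> 'a \<Rightarrow> real) \<Rightarrow> 'a \<Rightarrow> 'a \<Rightarrow> 'a \<Rightarrow> 'a \<Rightarrow> real" where
  "ext_deriv_2 \<omega> x u v w = fd (\<lambda>y. \<omega> y v w) x u + fd (\<lambda>y. \<omega> y w u) x v + fd (\<lambda>y. \<omega> y u v) x w"

lemma ext_deriv_2_ext_deriv_1:
  assumes S: "open S" "x \<in> S" and sm: "\<And>v. smooth_on S (\<lambda>y. \<theta> y v)"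
  shows "ext_deriv_2 (ext_deriv_1 \<theta>) x u v w = 0"
proof -
  have d: "fd (\<lambda>y. ext_deriv_1 \<theta> y p q) x r =
     fd (\<lambda>y. fd (\<lambda>z. \<theta> z q) y p) x r - fd (\<lambda>y. fd (\<lambda>z. \<theta> z p) y q) x r" for p q r
    unfolding ext_deriv_1_def
    by (intro fd_diff smooth_on_differentiable[OF smooth_on_fd[OF sm] S(2)])
  have sym: "fd (\<lambda>y. fd (\<lambda>z. \<theta> z a) y b) x c = fd (\<lambda>y. fd (\<lambda>z. \<theta> z a) y c) x b" for a b c
    by (rule second_derivative_symmetric[OF S sm])
  show ?thesis
    unfolding ext_deriv_2_def d
    using sym[of u v w] sym[of v u w] sym[of w u v]
    by simp
qed

text \<open>The second derivatives of \<open>f\<close> are symmetric and \<open>\<omega>\<close> is skew, so they cancel from the cyclic sum.\<close>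

lemma ext_deriv_2_pullback:
  fixes f :: "'a::real_normed_vector \<Rightarrow> 'b::euclidean_space"
  assumes N: "open N" "p \<in> N" and W: "open W" and sf: "smooth_on N f" and sub: "f ` N \<subseteq> W"
    and bil: "\<And>y. y \<in> W \<Longrightarrow> bilinear (\<omega> y)" and anti: "\<And>y u v. y \<in> W \<Longrightarrow> \<omega> y u v = - \<omega> y v u"
    and sm: "\<And>u v. smooth_on W (\<lambda>y. \<omega> y u v)"
  shows "ext_deriv_2 (\<lambda>z u v. \<omega> (f z) (fd f z u) (fd f z v)) p u v w =
    ext_deriv_2 \<omega> (f p) (fd f p u) (fd f p v) (fd f p w)"
proof -
  have fp: "f p \<in> W" using N sub by auto
  have dG: "(\<lambda>z. \<omega> (f z) a b) differentiable (at p)" for a b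
    by (rule smooth_on_differentiable[OF smooth_on_compose[OF N(1) W sf sm sub] N(2)])
  have deriv: "fd (\<lambda>z. \<omega> (f z) (fd f z a) (fd f z b)) p c =
      fd (\<lambda>y. \<omega> y (fd f p a) (fd f p b)) (f p) (fd f p c)
      + \<omega> (f p) (fd (\<lambda>z. fd f z a) p c) (fd f p b) + \<omega> (f p) (fd f p a) (fd (\<lambda>z. fd f z b) p c)" for a b c
  proof -
    have "((\<lambda>z. \<omega> (f z) (fd f z a) (fd f z b)) has_derivative
      (\<lambda>c. fd (\<lambda>z. \<omega> (f z) (fd f p a) (fd f p b)) p c
       + \<omega> (f p) (fd (\<lambda>z. fd f z a) p c) (fd f p b) + \<omega> (f p) (fd f p a) (fd (\<lambda>z. fd f z b) p c))) (at p)"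
      by (rule has_derivative_bilinear_field[OF N, of "\<lambda>z. \<omega> (f z)"])
        (use bil sub dG smooth_on_differentiable[OF smooth_on_fd[OF sf] N(2)] in auto)
    moreover have "fd (\<lambda>z. \<omega> (f z) (fd f p a) (fd f p b)) p c =
        fd (\<lambda>y. \<omega> y (fd f p a) (fd f p b)) (f p) (fd f p c)"
      by (rule fd_compose[OF smooth_on_differentiable[OF sf N(2)] smooth_on_differentiable[OF sm fp]])
    ultimately show ?thesis by (simp add: fd_eqI)
  qed
  have sym2: "fd (\<lambda>z. fd f z a) p b = fd (\<lambda>z. fd f z b) p a" for a b
    by (rule second_derivative_symmetric[OF N sf])
  show ?thesis
    unfolding ext_deriv_2_def deriv
    using sym2[of u v] sym2[of v w] sym2[of u w]
      anti[OF fp, of "fd (\<lambda>z. fd f z v) p u" "fd f p w"]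
      anti[OF fp, of "fd (\<lambda>z. fd f z w) p u" "fd f p v"]
      anti[OF fp, of "fd (\<lambda>z. fd f z w) p v" "fd f p u"]
    by simp
qed

section \<open>Nearly Kaehler structures in a chart\<close>

locale nearly_kaehler_chart =
  fixes M :: "('m, 'e::euclidean_space) chart set" and J :: "('m, 'e) endo_field"
    and g :: "('m, 'e) bilinear_field" and d :: "('m, 'e) chart"
  assumes nk: "nearly_kaehler M J g" and d: "d \<in> M" and open_image: "open (chart_image d)"
begin

abbreviation "W \<equiv> chart_image d"
abbreviation "\<omega> \<equiv> kaehler_form J g d"
abbreviation "\<Gamma> \<equiv> christoffel g d"
abbreviation "S \<equiv> cov_deriv_endo g J d"

definition "\<sigma> y u v w = g d y (S y u v) w"

lemma almost_hermitian: "almost_hermitian M J g"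
  using nk by (simp add: nearly_kaehler_def)

lemma metric: "riemannian_metric M g"
  using almost_hermitian by (simp add: almost_hermitian_def)

lemma smooth_fields: "smooth_bilinear_field M g" "smooth_endo_field M J"
  using almost_hermitian metric by (simp_all add: almost_hermitian_def riemannian_metric_def)

lemma g_bilinear: "y \<in> W \<Longrightarrow> bilinear (g d y)"
  using smooth_fields(1) d by (simp add: smooth_bilinear_field_def)

lemma g_sym: "y \<in> W \<Longrightarrow> g d y u v = g d y v u"
  using metric d unfolding riemannian_metric_def by blast

lemma g_pos: "y \<in> W \<Longrightarrow> u \<noteq> 0 \<Longrightarrow> 0 < g d y u u"
  using metric d by (simp add: riemannian_metric_def)

lemma g_smooth: "smooth_on W (\<lambda>y. g d y u v)"
  using smooth_fields(1) d by (simp add: smooth_bilinear_field_def)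

lemma J_linear: "y \<in> W \<Longrightarrow> linear (J d y)"
  using smooth_fields(2) d by (simp add: smooth_endo_field_def)

lemma J_smooth: "smooth_on W (\<lambda>y. J d y u)"
  using smooth_fields(2) d by (simp add: smooth_endo_field_def)

lemma J_J: "y \<in> W \<Longrightarrow> J d y (J d y u) = - u"
  using almost_hermitian d by (simp add: almost_hermitian_def)

lemma J_isometry: "y \<in> W \<Longrightarrow> g d y (J d y u) (J d y v) = g d y u v"
  using almost_hermitian d by (simp add: almost_hermitian_def)

lemma S_diag: "y \<in> W \<Longrightarrow> S y u u = 0"
  using nk d by (simp add: nearly_kaehler_def)

lemma g_inner_form: "y \<in> W \<Longrightarrow> inner_form (g d y)"
  unfolding inner_form_def using g_bilinear g_sym g_pos by blast

lemma omega_eq: "\<omega> y u v = g d y (J d y u) v"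
  by (simp add: kaehler_form_def)

lemma omega_skew: "y \<in> W \<Longrightarrow> \<omega> y u v = - \<omega> y v u"
  using J_isometry[of y u "J d y v"] J_J[of y v] g_sym[of y u "J d y v"] bilinear_rneg[OF g_bilinear, of y]
  by (simp add: omega_eq)

lemma omega_bilinear: "y \<in> W \<Longrightarrow> bilinear (\<omega> y)"
  by (intro bilinearI)
    (simp_all add: omega_eq linear_add[OF J_linear] linear_cmul[OF J_linear] bilinear_ladd[OF g_bilinear]
      bilinear_radd[OF g_bilinear] bilinear_lmul[OF g_bilinear] bilinear_rmul[OF g_bilinear])

lemma omega_smooth: "smooth_on W (\<lambda>y. \<omega> y u v)"
  unfolding omega_eq
  by (rule smooth_on_bilinear_field[OF open_image]) (auto simp: g_bilinear g_smooth J_smooth)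

context
  fixes x assumes x: "x \<in> W"
begin

lemma christoffel_bilinear: "bilinear (\<Gamma> x)"
  and christoffel_sym: "\<Gamma> x u v = \<Gamma> x v u"
  and christoffel_metric: "fd (\<lambda>y. g d y v w) x u = g d x (\<Gamma> x u v) w + g d x v (\<Gamma> x u w)"
  using christoffel_eqs[OF open_image x, of g] g_bilinear g_sym g_pos[OF x]
    smooth_on_differentiable[OF g_smooth x] by auto

lemma S_bilinear: "bilinear (S x)"
proof -
  note lin = linear_add[OF J_linear[OF x]] linear_cmul[OF J_linear[OF x]]
    bilinear_ladd[OF christoffel_bilinear] bilinear_radd[OF christoffel_bilinear]
    bilinear_lmul[OF christoffel_bilinear] bilinear_rmul[OF christoffel_bilinear]
  have l1: "linear (fd (\<lambda>y. J d y v) x)" for v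
    by (rule linear_frechet_derivative[OF smooth_on_differentiable[OF J_smooth x]])
  have l2: "linear (\<lambda>v. fd (\<lambda>y. J d y v) x u)" for u
    by (rule fd_linear_field[OF open_image x J_linear smooth_on_differentiable[OF J_smooth x]])
  show ?thesis
    by (intro bilinearI)
      (simp_all add: cov_deriv_endo_def lin linear_add[OF l1] linear_cmul[OF l1] linear_add[OF l2]
        linear_cmul[OF l2] algebra_simps)
qed

text \<open>Polarisation of \<open>(\<nabla>\<^sub>uJ)u = 0\<close>.\<close>

lemma S_skew: "S x u v = - S x v u"
proof -
  have "S x (u + v) (u + v) = S x u u + S x u v + (S x v u + S x v v)"
    by (simp add: bilinear_ladd[OF S_bilinear] bilinear_radd[OF S_bilinear])
  then have "S x u v + S x v u = S x (u + v) (u + v)"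
    unfolding S_diag[OF x, of u] S_diag[OF x, of v] by simp
  also have "\<dots> = 0" by (rule S_diag[OF x])
  finally show ?thesis by (simp add: eq_neg_iff_add_eq_0)
qed

text \<open>The metric is parallel, so differentiating \<open>\<omega> = \<langle>J\<cdot>, \<cdot>\<rangle>\<close> only leaves the derivative of \<open>J\<close>:
  \<open>(\<nabla>\<^sub>u\<omega>)(v, w) = \<sigma>(u, v, w)\<close>.\<close>

lemma omega_deriv: "fd (\<lambda>y. \<omega> y v w) x u = \<sigma> x u v w + \<omega> x (\<Gamma> x u v) w + \<omega> x v (\<Gamma> x u w)"
proof -
  have "((\<lambda>y. g d y (J d y v) w) has_derivative
     (\<lambda>u. fd (\<lambda>y. g d y (J d x v) w) x u + g d x (fd (\<lambda>y. J d y v) x u) w + g d x (J d x v) (fd (\<lambda>y. w) x u))) (at x)"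
    by (rule has_derivative_bilinear_field[OF open_image x])
      (auto simp: g_bilinear smooth_on_differentiable[OF g_smooth x] smooth_on_differentiable[OF J_smooth x])
  then show ?thesis
    unfolding omega_eq
    by (simp add: fd_eqI \<sigma>_def cov_deriv_endo_def christoffel_metric bilinear_ladd[OF g_bilinear[OF x]]
      bilinear_lsub[OF g_bilinear[OF x]] bilinear_rzero[OF g_bilinear[OF x]])
qed

lemma sigma_skew12: "\<sigma> x u v w = - \<sigma> x v u w"
  using S_skew[of u v] by (simp add: \<sigma>_def bilinear_lneg[OF g_bilinear[OF x]])

text \<open>\<open>\<nabla>\<^sub>u\<omega>\<close> is a two-form because \<open>\<omega>\<close> is.\<close>

lemma sigma_skew23: "\<sigma> x u v w = - \<sigma> x u w v"
proof -
  have "fd (\<lambda>y. \<omega> y v w) x u = fd (\<lambda>y. - \<omega> y w v) x u"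
    by (rule fun_cong[OF fd_cong[OF open_image x]]) (rule omega_skew)
  also have "\<dots> = - fd (\<lambda>y. \<omega> y w v) x u"
    by (rule fd_minus[OF smooth_on_differentiable[OF omega_smooth x]])
  finally show ?thesis
    using omega_skew[OF x, of v "\<Gamma> x u w"] omega_skew[OF x, of w "\<Gamma> x u v"]
    unfolding omega_deriv by linarith
qed

lemma sigma_linear: "linear (\<lambda>u. \<sigma> x u v w)"
  by (rule linearI)
    (simp_all add: \<sigma>_def bilinear_ladd[OF S_bilinear] bilinear_lmul[OF S_bilinear]
      bilinear_ladd[OF g_bilinear[OF x]] bilinear_lmul[OF g_bilinear[OF x]])

text \<open>The Christoffel terms of \<open>omega_deriv\<close> cancel from the cyclic sum because the connection has no torsion,
  and the three remaining terms are equal because \<open>\<sigma>\<close> is alternating.\<close>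

lemma ext_deriv_omega: "ext_deriv_2 \<omega> x u v w = 3 * \<sigma> x u v w"
proof -
  have "ext_deriv_2 \<omega> x u v w = \<sigma> x u v w + \<sigma> x v w u + \<sigma> x w u v"
    unfolding ext_deriv_2_def omega_deriv
      christoffel_sym[of v u] christoffel_sym[of w u] christoffel_sym[of w v]
    using omega_skew[OF x, of "\<Gamma> x u v" w] omega_skew[OF x, of "\<Gamma> x v w" u] omega_skew[OF x, of "\<Gamma> x u w" v]
    by linarith
  also have "\<dots> = 3 * \<sigma> x u v w"
    using sigma_skew12[of v w u] sigma_skew12[of w u v] sigma_skew23[of w v u] sigma_skew23[of u w v]
      sigma_skew12[of w v u] sigma_skew23[of v u w] sigma_skew12[of u v w] sigma_skew23[of v w u]
      sigma_skew12[of u w v]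
    by linarith
  finally show ?thesis .
qed

text \<open>This is the derivative of \<open>J\<^sup>2 = -1\<close>.\<close>

lemma S_J: "S x u (J d x v) = - J d x (S x u v)"
proof -
  have "((\<lambda>y. J d y (J d y v)) has_derivative
     (\<lambda>u. fd (\<lambda>y. J d y (J d x v)) x u + J d x (fd (\<lambda>y. J d y v) x u))) (at x)"
    by (rule has_derivative_linear_field[OF open_image x])
      (auto simp: J_linear smooth_on_differentiable[OF J_smooth x])
  from fd_eqI[OF this] have "fd (\<lambda>y. J d y (J d x v)) x u + J d x (fd (\<lambda>y. J d y v) x u)
      = fd (\<lambda>y. J d y (J d y v)) x u" by simp
  also have "\<dots> = 0"
    using fd_cong[OF open_image x, of "\<lambda>y. J d y (J d y v)" "\<lambda>y. - v"] J_J by simp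
  finally have "fd (\<lambda>y. J d y (J d x v)) x u = - J d x (fd (\<lambda>y. J d y v) x u)"
    by (simp add: eq_neg_iff_add_eq_0)
  then show ?thesis
    by (simp add: cov_deriv_endo_def J_J[OF x] linear_add[OF J_linear[OF x]] linear_diff[OF J_linear[OF x]]
      bilinear_rneg[OF christoffel_bilinear])
qed

lemma sigma_J: "\<sigma> x u (J d x v) w = \<sigma> x u v (J d x w)"
proof -
  have "\<sigma> x u (J d x v) w = - g d x (J d x (S x u v)) w"
    unfolding \<sigma>_def S_J by (rule bilinear_lneg[OF g_bilinear[OF x]])
  also have "\<dots> = g d x (J d x w) (S x u v)"
    using omega_skew[OF x, of "S x u v" w] unfolding omega_eq by linarith
  also have "\<dots> = \<sigma> x u v (J d x w)"
    unfolding \<sigma>_def by (rule g_sym[OF x])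
  finally show ?thesis .
qed

end

end

section \<open>Alternating three-forms\<close>

definition alternating_3 :: "('e::real_vector \<Rightarrow> 'e \<Rightarrow> 'e \<Rightarrow> real) \<Rightarrow> bool" where
  "alternating_3 \<psi> \<longleftrightarrow> (\<forall>v w. linear (\<lambda>u. \<psi> u v w)) \<and>
     (\<forall>u v w. \<psi> u v w = - \<psi> v u w) \<and> (\<forall>u v w. \<psi> u v w = - \<psi> u w v)"

context
  fixes \<psi> :: "'e::real_vector \<Rightarrow> 'e \<Rightarrow> 'e \<Rightarrow> real"
  assumes \<psi>: "alternating_3 \<psi>"
begin

lemma alternating_3_skew12: "\<psi> u v w = - \<psi> v u w"
  and alternating_3_skew23: "\<psi> u v w = - \<psi> u w v"
  and alternating_3_linear: "linear (\<lambda>u. \<psi> u v w)"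
  using \<psi> unfolding alternating_3_def by blast+

lemma alternating_3_cyclic: "\<psi> u v w = \<psi> v w u"
  using alternating_3_skew12[of u v w] alternating_3_skew23[of v u w] by linarith

lemma alternating_3_add1: "\<psi> (u + u') v w = \<psi> u v w + \<psi> u' v w"
  by (rule linear_add[OF alternating_3_linear])

lemma alternating_3_scale1: "\<psi> (c *\<^sub>R u) v w = c * \<psi> u v w"
  using linear_cmul[OF alternating_3_linear] by simp

lemma alternating_3_linear2: "linear (\<lambda>v. \<psi> u v w)"
  using alternating_3_linear[of w u] alternating_3_cyclic[of u _ w] by simp

lemma alternating_3_linear3: "linear (\<lambda>w. \<psi> u v w)"
  using alternating_3_linear[of u v] alternating_3_cyclic[of _ u v] by simp

lemma alternating_3_add2: "\<psi> u (v + v') w = \<psi> u v w + \<psi> u v' w"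
  by (rule linear_add[OF alternating_3_linear2])

lemma alternating_3_scale2: "\<psi> u (c *\<^sub>R v) w = c * \<psi> u v w"
  using linear_cmul[OF alternating_3_linear2] by simp

lemma alternating_3_add3: "\<psi> u v (w + w') = \<psi> u v w + \<psi> u v w'"
  by (rule linear_add[OF alternating_3_linear3])

lemma alternating_3_scale3: "\<psi> u v (c *\<^sub>R w) = c * \<psi> u v w"
  using linear_cmul[OF alternating_3_linear3] by simp

lemma alternating_3_refl: "\<psi> u u w = 0" "\<psi> u w w = 0" "\<psi> u w u = 0"
  using alternating_3_skew12[of u u w] alternating_3_skew23[of u w w]
    alternating_3_skew12[of u w u] alternating_3_skew23[of w u u] by linarith+

lemmas alternating_3_multilinear =
  alternating_3_add1 alternating_3_scale1 alternating_3_add2 alternating_3_scale2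
  alternating_3_add3 alternating_3_scale3 alternating_3_refl

lemma alternating_3_det:
  "\<psi> (a1 *\<^sub>R e1 + a2 *\<^sub>R e2 + a3 *\<^sub>R e3) (b1 *\<^sub>R e1 + b2 *\<^sub>R e2 + b3 *\<^sub>R e3) (c1 *\<^sub>R e1 + c2 *\<^sub>R e2 + c3 *\<^sub>R e3)
    = (a1 * (b2 * c3 - b3 * c2) - a2 * (b1 * c3 - b3 * c1) + a3 * (b1 * c2 - b2 * c1)) * \<psi> e1 e2 e3"
proof -
  have p: "\<psi> e2 e1 e3 = - \<psi> e1 e2 e3" "\<psi> e1 e3 e2 = - \<psi> e1 e2 e3" "\<psi> e3 e2 e1 = - \<psi> e1 e2 e3"
    "\<psi> e2 e3 e1 = \<psi> e1 e2 e3" "\<psi> e3 e1 e2 = \<psi> e1 e2 e3"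
    using alternating_3_skew12[of e2 e1 e3] alternating_3_skew23[of e1 e3 e2] alternating_3_skew12[of e3 e2 e1]
      alternating_3_cyclic[of e1 e2 e3] alternating_3_cyclic[of e2 e3 e1] by linarith+
  show ?thesis
    unfolding alternating_3_multilinear p by (simp add: algebra_simps)
qed

end

lemma orthonormal_basis_3:
  fixes b :: "'e::euclidean_space \<Rightarrow> 'e \<Rightarrow> real"
  assumes "inner_form b" "orthonormal_basis b B" "DIM('e) = 3"
  obtains a1 a2 a3 where "B = {a1, a2, a3}" "a1 \<noteq> a2" "a1 \<noteq> a3" "a2 \<noteq> a3"
    "\<And>u. u = b u a1 *\<^sub>R a1 + b u a2 *\<^sub>R a2 + b u a3 *\<^sub>R a3"
    "\<And>u v. b u v = b u a1 * b v a1 + b u a2 * b v a2 + b u a3 * b v a3"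
proof -
  have bil: "bilinear b" and sym: "\<And>u v. b u v = b v u" using assms(1) by (simp_all add: inner_form_def)
  have "card B = 3" using orthonormal_basis_card[OF bil assms(2)] assms(3) by simp
  then obtain a1 a2 a3 where B: "B = {a1, a2, a3}" "a1 \<noteq> a2" "a1 \<noteq> a3" "a2 \<noteq> a3"
    by (auto simp: card_3_iff)
  show ?thesis
  proof (rule that[OF B])
    fix u v
    show "u = b u a1 *\<^sub>R a1 + b u a2 *\<^sub>R a2 + b u a3 *\<^sub>R a3"
      using orthonormal_expansion[OF bil, of B u] assms(2) B by (simp add: orthonormal_basis_iff add.assoc)
    show "b u v = b u a1 * b v a1 + b u a2 * b v a2 + b u a3 * b v a3"
      using orthonormal_basis_inner[OF bil assms(2) sym, of u v] B by (simp add: add.assoc)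
  qed
qed

text \<open>In dimension three an alternating form of square \<open>\<alpha>\<close> on orthonormal bases is \<open>\<surd>\<alpha>\<close> times a volume form;
  the other factor on the right is the Gram determinant of \<open>u, v, w\<close>.\<close>

lemma alternating_3_gram:
  fixes h :: "'e::euclidean_space \<Rightarrow> 'e \<Rightarrow> real"
  assumes \<psi>: "alternating_3 \<psi>" and h: "inner_form h" and dim: "DIM('e) = 3"
    and unit: "\<And>a1 a2 a3. orthonormal_basis h {a1, a2, a3} \<Longrightarrow> a1 \<noteq> a2 \<Longrightarrow> a1 \<noteq> a3 \<Longrightarrow> a2 \<noteq> a3 \<Longrightarrow> (\<psi> a1 a2 a3)\<^sup>2 = \<alpha>"
  shows "(\<psi> u v w)\<^sup>2 = \<alpha> * (h u u * (h v v * h w w - h v w * h v w)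
    - h u v * (h u v * h w w - h v w * h u w) + h u w * (h u v * h v w - h v v * h u w))"
proof -
  obtain B where B: "orthonormal_basis h B" using orthonormal_basis_exists[OF h] by blast
  obtain a1 a2 a3 where a: "B = {a1, a2, a3}" "a1 \<noteq> a2" "a1 \<noteq> a3" "a2 \<noteq> a3"
    and ex: "\<And>u. u = h u a1 *\<^sub>R a1 + h u a2 *\<^sub>R a2 + h u a3 *\<^sub>R a3"
    and h_eq: "\<And>u v. h u v = h u a1 * h v a1 + h u a2 * h v a2 + h u a3 * h v a3"
    using orthonormal_basis_3[OF h B dim] by blast
  define k where "k = \<psi> a1 a2 a3"
  have k: "k\<^sup>2 = \<alpha>" unfolding k_def using unit B a by blast
  have "\<psi> u v w = (h u a1 * (h v a2 * h w a3 - h v a3 * h w a2) - h u a2 * (h v a1 * h w a3 - h v a3 * h w a1)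
     + h u a3 * (h v a1 * h w a2 - h v a2 * h w a1)) * k"
    using alternating_3_det[OF \<psi>, of "h u a1" a1 "h u a2" a2 "h u a3" a3 "h v a1" "h v a2" "h v a3" "h w a1" "h w a2" "h w a3"]
    unfolding ex[symmetric] k_def .
  then show ?thesis
    unfolding h_eq[of u u] h_eq[of u v] h_eq[of u w] h_eq[of v v] h_eq[of v w] h_eq[of w w] k[symmetric]
    by algebra
qed

section \<open>Linear algebra of a Lagrangian subspace\<close>

text \<open>The situation at one point: \<open>D\<close> is the differential of a Lagrangian immersion, \<open>S u v = (\<nabla>\<^sub>uJ)v\<close>, and \<open>T\<close>
  is the three-form \<open>\<sigma>\<close>, which is assumed to vanish on the image of \<open>D\<close>.\<close>

locale lagrangian_subspace =
  fixes G :: "'e::euclidean_space \<Rightarrow> 'e \<Rightarrow> real" and I :: "'e \<Rightarrow> 'e"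
    and S :: "'e \<Rightarrow> 'e \<Rightarrow> 'e" and T :: "'e \<Rightarrow> 'e \<Rightarrow> 'e \<Rightarrow> real" and \<alpha> :: real
    and D :: "'f::euclidean_space \<Rightarrow> 'e"
  assumes G: "inner_form G" and I: "linear I"
    and I_I: "\<And>u. I (I u) = - u" and I_isometry: "\<And>u v. G (I u) (I v) = G u v"
    and T: "alternating_3 T" and T_I: "\<And>u v w. T u (I v) w = T u v (I w)"
    and T_S: "\<And>u v w. T u v w = G (S u v) w"
    and S_norm: "\<And>u v. G (S u v) (S u v) = \<alpha> * (G u u * G v v - (G u v)\<^sup>2 - (G u (I v))\<^sup>2)"
    and D: "linear D" "inj D" and dim: "2 * DIM('f) = DIM('e)"
    and lagrangian: "\<And>u v. G (I (D u)) (D v) = 0"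
    and T_tangent: "\<And>u v w. T (D u) (D v) (D w) = 0"
begin

text \<open>The induced metric, and the three-form that will turn out to be \<open>\<surd>\<alpha>\<close> times a volume form.\<close>

definition "h u v = G (D u) (D v)"
definition "\<psi> u v w = T (I (D u)) (D v) (D w)"

lemma G_bilinear: "bilinear G" and G_sym: "G u v = G v u"
  using G by (simp_all add: inner_form_def)

lemma h_inner_form: "inner_form h"
proof -
  have "D u \<noteq> 0" if "u \<noteq> 0" for u
    using that D by (metis injD linear_0)
  moreover have "bilinear h"
    by (intro bilinearI)
      (simp_all add: h_def linear_add[OF D(1)] linear_cmul[OF D(1)] bilinear_ladd[OF G_bilinear]
        bilinear_radd[OF G_bilinear] bilinear_lmul[OF G_bilinear] bilinear_rmul[OF G_bilinear])
  ultimately show ?thesis using G by (simp add: inner_form_def h_def)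
qed

text \<open>Moving \<open>I\<close> from one argument of \<open>T\<close> to another does not change the value, so the first argument of \<open>\<psi>\<close>,
  which carries \<open>I\<close>, can be exchanged with the second.\<close>

lemma psi_alternating: "alternating_3 \<psi>"
  unfolding alternating_3_def
proof (intro conjI allI)
  fix u v w
  show "linear (\<lambda>u. \<psi> u v w)"
    by (rule linearI)
      (simp_all add: \<psi>_def linear_add[OF D(1)] linear_cmul[OF D(1)] linear_add[OF I] linear_cmul[OF I]
        alternating_3_add1[OF T] alternating_3_scale1[OF T])
  show "\<psi> u v w = - \<psi> u w v"
    unfolding \<psi>_def by (rule alternating_3_skew23[OF T])
  show "\<psi> u v w = - \<psi> v u w"
    unfolding \<psi>_def
    using alternating_3_skew12[OF T, of "I (D u)" "D v" "D w"] T_I[of "D v" "D u" "D w"]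
      alternating_3_skew12[OF T, of "I (D v)" "D u" "D w"] T_I[of "D u" "D v" "D w"]
      alternating_3_skew12[OF T, of "D u" "D v" "I (D w)"] by linarith
qed

text \<open>The Lagrangian condition says that \<open>I\<close> maps the tangent space into its orthogonal complement; counting
  dimensions, an orthonormal basis of the tangent space and its image under \<open>I\<close> form one of the ambient
  space.\<close>

lemma adapted_basis:
  assumes B: "orthonormal_basis h B"
  shows "orthonormal_basis G (D ` B \<union> (\<lambda>e. I (D e)) ` B)"
    and "D ` B \<inter> (\<lambda>e. I (D e)) ` B = {}" and "inj_on D B" and "inj_on (\<lambda>e. I (D e)) B"
proof -
  have o: "G (D e) (D f) = (if e = f then 1 else 0)" if "e \<in> B" "f \<in> B" for e f
    using B that by (auto simp: orthonormal_basis_def h_def)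
  show inj_D: "inj_on D B" using D(2) by (rule inj_on_subset) simp
  have "inj I" by (rule injI) (metis I_I neg_equal_iff_equal)
  then show inj_ID: "inj_on (\<lambda>e. I (D e)) B" using D(2) by (auto simp: inj_on_def)
  show disj: "D ` B \<inter> (\<lambda>e. I (D e)) ` B = {}"
  proof (rule ccontr)
    assume "\<not> ?thesis"
    then obtain e f where ef: "e \<in> B" "D e = I (D f)" by auto
    then have "G (D e) (D e) = 0" using lagrangian[of f e] by simp
    then show False using o[OF ef(1) ef(1)] by simp
  qed
  have fin: "finite B" using B by (simp add: orthonormal_basis_def)
  have "card B = DIM('f)"
    using orthonormal_basis_card[OF _ B] h_inner_form by (simp add: inner_form_def)
  then have "card (D ` B \<union> (\<lambda>e. I (D e)) ` B) = DIM('e)"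
    using card_Un_disjoint[OF _ _ disj] fin dim by (simp add: card_image[OF inj_D] card_image[OF inj_ID])
  moreover have "orthonormal_set G (D ` B \<union> (\<lambda>e. I (D e)) ` B)"
    unfolding orthonormal_set_def
  proof (intro conjI ballI)
    show "finite (D ` B \<union> (\<lambda>e. I (D e)) ` B)" using fin by simp
    fix p q assume pq: "p \<in> D ` B \<union> (\<lambda>e. I (D e)) ` B" "q \<in> D ` B \<union> (\<lambda>e. I (D e)) ` B"
    have DD: "D e = D f \<longleftrightarrow> e = f" for e f using D(2) by (auto dest: injD)
    have II: "I e = I f \<longleftrightarrow> e = f" for e f using \<open>inj I\<close> by (auto dest: injD)
    consider (1) e f where "e \<in> B" "f \<in> B" "p = D e" "q = D f"
      | (2) e f where "e \<in> B" "f \<in> B" "p = I (D e)" "q = I (D f)"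
      | (3) e f where "e \<in> B" "f \<in> B" "p = D e" "q = I (D f)"
      | (4) e f where "e \<in> B" "f \<in> B" "p = I (D e)" "q = D f"
      using pq by blast
    then show "G p q = (if p = q then 1 else 0)"
    proof cases
      case 1 then show ?thesis using o by (simp add: DD)
    next
      case 2 then show ?thesis using o by (simp add: DD II I_isometry)
    next
      case 3
      then have "p \<noteq> q" using disj by blast
      then show ?thesis using 3 lagrangian[of f e] G_sym[of p q] by simp
    next
      case 4
      then have "p \<noteq> q" using disj by blast
      then show ?thesis using 4 lagrangian[of e f] by simp
    qed
  qed
  ultimately show "orthonormal_basis G (D ` B \<union> (\<lambda>e. I (D e)) ` B)"
    by (intro orthonormal_basisI G_bilinear)
qed

lemma adapted_sum:
  fixes \<phi> :: "'e \<Rightarrow> 'c::comm_monoid_add"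
  assumes B: "orthonormal_basis h B"
  shows "(\<Sum>p \<in> D ` B \<union> (\<lambda>e. I (D e)) ` B. \<phi> p) = (\<Sum>e\<in>B. \<phi> (D e)) + (\<Sum>e\<in>B. \<phi> (I (D e)))"
proof -
  have "finite B" using B by (simp add: orthonormal_basis_def)
  then show ?thesis
    using adapted_basis[OF B] by (simp add: sum.union_disjoint sum.reindex)
qed

lemma tangent_normal_decomposition: "\<exists>a b. v = D a + I (D b)"
proof -
  obtain B where B: "orthonormal_basis h B" using orthonormal_basis_exists[OF h_inner_form] by blast
  have "v = (\<Sum>p \<in> D ` B \<union> (\<lambda>e. I (D e)) ` B. G v p *\<^sub>R p)"
    using adapted_basis(1)[OF B] by (intro orthonormal_expansion[OF G_bilinear]) (simp_all add: orthonormal_basis_iff)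
  also have "\<dots> = D (\<Sum>e\<in>B. G v (D e) *\<^sub>R e) + I (D (\<Sum>e\<in>B. G v (I (D e)) *\<^sub>R e))"
    unfolding adapted_sum[OF B] by (simp add: linear_sum[OF D(1)] linear_sum[OF I] linear_cmul[OF D(1)] linear_cmul[OF I])
  finally show ?thesis by blast
qed

text \<open>\<open>S (D a1) (D a2)\<close> has no tangential components because \<open>T\<close> vanishes on the tangent space. Of its
  normal components \<open>\<psi> e a1 a2\<close>, only the one with \<open>e = a3\<close> is non-zero, so the prescribed length is its
  square.\<close>

lemma psi_norm:
  assumes "orthonormal_basis h {a1, a2, a3}" "a1 \<noteq> a2" "a1 \<noteq> a3" "a2 \<noteq> a3"
  shows "(\<psi> a1 a2 a3)\<^sup>2 = \<alpha>"
proof -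
  have o: "h a1 a1 = 1" "h a2 a2 = 1" "h a1 a2 = 0"
    using assms by (simp_all add: orthonormal_basis_def)
  have psi: "T (D u) (D v) (I (D w)) = \<psi> u v w" for u v w
    unfolding \<psi>_def
    using alternating_3_skew12[OF T, of "I (D u)" "D v" "D w"] T_I[of "D v" "D u" "D w"]
      alternating_3_skew12[OF T, of "D u" "D v" "I (D w)"] by linarith
  have "G (S (D a1) (D a2)) (S (D a1) (D a2)) =
      (\<Sum>p \<in> D ` {a1, a2, a3} \<union> (\<lambda>e. I (D e)) ` {a1, a2, a3}. G (S (D a1) (D a2)) p * G (S (D a1) (D a2)) p)"
    by (rule orthonormal_basis_inner[OF G_bilinear adapted_basis(1)[OF assms(1)] G_sym])
  also have "\<dots> = (\<psi> a1 a2 a3)\<^sup>2"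
    unfolding adapted_sum[OF assms(1)] T_S[symmetric] T_tangent psi
    using assms by (simp add: alternating_3_refl[OF psi_alternating] power2_eq_square)
  finally show ?thesis
    using S_norm[of "D a1" "D a2"] o lagrangian[of a2 a1] G_sym[of "D a1" "I (D a2)"] by (simp add: h_def)
qed

text \<open>For \<open>x = D a + I (D b)\<close> take \<open>w = -b\<close>: the tangential part \<open>D a\<close> is annihilated in the first equation by the
  Lagrangian condition and in the second by the vanishing of \<open>T\<close> on tangent vectors.\<close>

lemma normal_contraction:
  "\<exists>w. (\<forall>u. G (I x) (D u) = h w u) \<and> (\<forall>u v. - T x (D u) (D v) = \<psi> w u v)"
proof -
  obtain a b where x: "x = D a + I (D b)" using tangent_normal_decomposition by blast
  have "I x = I (D a) - D b" by (simp add: x linear_add[OF I] I_I)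
  then have "G (I x) (D u) = h (- b) u" for u
    by (simp add: h_def bilinear_lsub[OF G_bilinear] lagrangian linear_neg[OF D(1)] bilinear_lneg[OF G_bilinear])
  moreover have "- T x (D u) (D v) = \<psi> (- b) u v" for u v
    using alternating_3_scale1[OF psi_alternating, of "-1" b u v]
    by (simp add: x alternating_3_add1[OF T] T_tangent \<psi>_def)
  ultimately show ?thesis by blast
qed

end

section \<open>The equation \<open>d\<tau> = 3\<psi>(\<tau>\<^sup>#, \<cdot>, \<cdot>)\<close> in dimension three\<close>

lemma has_derivative_eq_on_open:
  assumes "open U" "x \<in> U" "\<And>y. y \<in> U \<Longrightarrow> f y = g y"
    and "(f has_derivative f') (at x)" "(g has_derivative g') (at x)"
  shows "f' u = g' u"
  using fd_cong[OF assms(1-3)] fd_eqI[OF assms(4)] fd_eqI[OF assms(5)] by simp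

text \<open>On a metric \<open>h\<close> in three dimensions, a one-form \<open>\<tau>\<close> whose exterior derivative is the contraction of \<open>3\<psi>\<close>
  with the dual vector \<open>w\<close> of \<open>\<tau>\<close>. Locally \<open>\<psi>\<close> is \<open>\<surd>\<alpha>\<close> times a volume form, so that the last assumption is
  the first-order equation \<open>*d\<tau> = 3\<surd>\<alpha> \<tau>\<close>.\<close>

locale curl_eigenform =
  fixes h :: "('l, 'f::euclidean_space) bilinear_field" and c :: "('l, 'f) chart" and U :: "'f set"
    and \<tau> :: "'f \<Rightarrow> 'f \<Rightarrow> real" and \<psi> :: "'f \<Rightarrow> 'f \<Rightarrow> 'f \<Rightarrow> 'f \<Rightarrow> real" and \<alpha> :: real
  assumes dim: "DIM('f) = 3" and U: "open U" and \<alpha>: "0 < \<alpha>"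
    and h: "\<And>y. y \<in> U \<Longrightarrow> inner_form (h c y)" and h_smooth: "\<And>u v. smooth_on U (\<lambda>y. h c y u v)"
    and \<tau>_smooth: "\<And>u. smooth_on U (\<lambda>y. \<tau> y u)"
    and \<psi>: "\<And>y. y \<in> U \<Longrightarrow> alternating_3 (\<psi> y)" and \<psi>_smooth: "\<And>u v w. smooth_on U (\<lambda>y. \<psi> y u v w)"
    and \<psi>_norm: "\<And>y a1 a2 a3. y \<in> U \<Longrightarrow> orthonormal_basis (h c y) {a1, a2, a3} \<Longrightarrow>
      a1 \<noteq> a2 \<Longrightarrow> a1 \<noteq> a3 \<Longrightarrow> a2 \<noteq> a3 \<Longrightarrow> (\<psi> y a1 a2 a3)\<^sup>2 = \<alpha>"
    and curl: "\<And>y. y \<in> U \<Longrightarrow> \<exists>w. (\<forall>u. \<tau> y u = h c y w u) \<and> (\<forall>u v. ext_deriv_1 \<tau> y u v = 3 * \<psi> y w u v)"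
begin

abbreviation "d\<tau> \<equiv> ext_deriv_1 \<tau>"

lemma h_bilinear: "y \<in> U \<Longrightarrow> bilinear (h c y)" and h_sym: "y \<in> U \<Longrightarrow> h c y u v = h c y v u"
  using h unfolding inner_form_def by blast+

lemma tau_linear: assumes y: "y \<in> U" shows "linear (\<tau> y)"
proof -
  obtain w where "\<tau> y = h c y w" using curl[OF y] by blast
  then show ?thesis using h_bilinear[OF y] by (simp add: bilinear_def)
qed

lemma d_tau_linear: assumes y: "y \<in> U" shows "linear (\<lambda>u. d\<tau> y u v)" "linear (d\<tau> y u)"
proof -
  obtain w where "\<And>u v. d\<tau> y u v = 3 * \<psi> y w u v" using curl[OF y] by blast
  then show "linear (\<lambda>u. d\<tau> y u v)" "linear (d\<tau> y u)"
    by (auto intro!: linearI simp: alternating_3_multilinear[OF \<psi>[OF y]] algebra_simps)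
qed

lemma d_tau_smooth: "smooth_on U (\<lambda>y. d\<tau> y u v)"
  using smooth_on_add[OF U smooth_on_fd[OF \<tau>_smooth[of v], of u] smooth_on_minus[OF U smooth_on_fd[OF \<tau>_smooth[of u], of v]]]
  by (simp add: ext_deriv_1_def)

text \<open>If \<open>w = a1 e1 + a2 e2 + a3 e3\<close> then \<open>d\<tau>(e2, e3) = 3 a1 \<psi>(e1, e2, e3)\<close> and cyclically, while
  \<open>\<tau>(u) = \<langle>w, u\<rangle>\<close>. Multiplying the latter by \<open>3\<psi>(e1, e2, e3)\<close> eliminates the unknown \<open>w\<close> without a division.
  The frame may be arbitrary, as needed for an identity that is to be differentiated.\<close>

lemma curl_in_frame:
  assumes y: "y \<in> U" and span: "span {e1, e2, e3} = UNIV"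
  shows "3 * \<psi> y e1 e2 e3 * \<tau> y u = h c y u e1 * d\<tau> y e2 e3 + h c y u e2 * d\<tau> y e3 e1 + h c y u e3 * d\<tau> y e1 e2"
proof -
  obtain w where w: "\<And>u. \<tau> y u = h c y w u" "\<And>u v. d\<tau> y u v = 3 * \<psi> y w u v" using curl[OF y] by blast
  obtain a1 a2 a3 where a: "w = a1 *\<^sub>R e1 + a2 *\<^sub>R e2 + a3 *\<^sub>R e3"
  proof -
    have "w \<in> span {e1, e2, e3}" using span by simp
    then obtain k1 k2 k3 where "w - k1 *\<^sub>R e1 - k2 *\<^sub>R e2 - k3 *\<^sub>R e3 = 0"
      unfolding span_breakdown_eq span_empty by blast
    then have "w = k1 *\<^sub>R e1 + k2 *\<^sub>R e2 + k3 *\<^sub>R e3" by (simp add: algebra_simps)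
    then show ?thesis by (rule that)
  qed
  note \<psi>y = \<psi>[OF y]
  have d: "d\<tau> y e2 e3 = 3 * a1 * \<psi> y e1 e2 e3" "d\<tau> y e3 e1 = 3 * a2 * \<psi> y e1 e2 e3" "d\<tau> y e1 e2 = 3 * a3 * \<psi> y e1 e2 e3"
    unfolding w(2) a alternating_3_multilinear[OF \<psi>y]
    using alternating_3_cyclic[OF \<psi>y, of e1 e2 e3] alternating_3_cyclic[OF \<psi>y, of e2 e3 e1] by simp_all
  have "\<tau> y u = h c y u w" unfolding w(1) by (rule h_sym[OF y])
  also have "\<dots> = a1 * h c y u e1 + a2 * h c y u e2 + a3 * h c y u e3"
    unfolding a by (simp add: bilinear_radd[OF h_bilinear[OF y]] bilinear_rmul[OF h_bilinear[OF y]])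
  finally show ?thesis unfolding d by (simp add: algebra_simps)
qed

text \<open>From here on \<open>e1, e2, e3\<close> is a frame of constant vector fields, orthonormal at the point \<open>x\<close>.\<close>

context
  fixes x e1 e2 e3
  assumes x: "x \<in> U" and onb: "orthonormal_basis (h c x) {e1, e2, e3}"
    and distinct: "e1 \<noteq> e2" "e1 \<noteq> e3" "e2 \<noteq> e3"
begin

abbreviation "\<Gamma> \<equiv> christoffel h c x"
abbreviation "K y \<equiv> \<psi> y e1 e2 e3"

definition "\<gamma> u v w = h c x (\<Gamma> u v) w"

lemma span_frame: "span {e1, e2, e3} = UNIV"
  using onb by (simp add: orthonormal_basis_def)

lemma h_frame:
  "h c x e1 e1 = 1" "h c x e2 e2 = 1" "h c x e3 e3 = 1" "h c x e1 e2 = 0" "h c x e1 e3 = 0" "h c x e2 e3 = 0"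
  "h c x e2 e1 = 0" "h c x e3 e1 = 0" "h c x e3 e2 = 0"
  using onb distinct by (auto simp: orthonormal_basis_def)

lemma frame_expansion: "u = h c x u e1 *\<^sub>R e1 + h c x u e2 *\<^sub>R e2 + h c x u e3 *\<^sub>R e3"
  using orthonormal_expansion[OF h_bilinear[OF x], of "{e1, e2, e3}" u] onb distinct
  by (simp add: orthonormal_basis_iff add.assoc)

lemma gamma_sym: "\<gamma> u v w = \<gamma> v u w"
  and h_deriv: "fd (\<lambda>y. h c y v w) x u = \<gamma> u v w + \<gamma> u w v"
  using christoffel_eqs(2,3)[OF U x, of h] h_bilinear h_sym h[OF x] smooth_on_differentiable[OF h_smooth x]
  unfolding \<gamma>_def inner_form_def by auto

lemma frame_derivatives:
  "((\<lambda>y. h c y u v) has_derivative fd (\<lambda>y. h c y u v) x) (at x)"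
  "((\<lambda>y. \<tau> y u) has_derivative fd (\<lambda>y. \<tau> y u) x) (at x)"
  "((\<lambda>y. d\<tau> y u v) has_derivative fd (\<lambda>y. d\<tau> y u v) x) (at x)"
  "(K has_derivative fd K x) (at x)"
  by (intro smooth_on_has_derivative[OF _ x] h_smooth \<tau>_smooth d_tau_smooth \<psi>_smooth)+

lemma K_square: "(K x)\<^sup>2 = \<alpha>"
  using \<psi>_norm[OF x onb] distinct by blast

lemma K_nonzero: "K x \<noteq> 0"
  using K_square \<alpha> by auto

text \<open>This is \<open>\<nabla>\<psi> = 0\<close> in components. At \<open>x\<close>, where the Gram matrix is the identity, the derivative of its
  determinant is the sum of the derivatives of its diagonal entries.\<close>

lemma K_deriv: "fd K x u = K x * (\<gamma> u e1 e1 + \<gamma> u e2 e2 + \<gamma> u e3 e3)"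
proof -
  have L: "((\<lambda>y. (K y)\<^sup>2) has_derivative (\<lambda>u. 2 * K x * fd K x u)) (at x)"
    by (auto intro!: derivative_eq_intros frame_derivatives)
  have R: "((\<lambda>y. \<alpha> * (h c y e1 e1 * (h c y e2 e2 * h c y e3 e3 - h c y e2 e3 * h c y e2 e3)
    - h c y e1 e2 * (h c y e1 e2 * h c y e3 e3 - h c y e2 e3 * h c y e1 e3)
    + h c y e1 e3 * (h c y e1 e2 * h c y e2 e3 - h c y e2 e2 * h c y e1 e3)))
    has_derivative (\<lambda>u. \<alpha> * (2 * (\<gamma> u e1 e1 + \<gamma> u e2 e2 + \<gamma> u e3 e3)))) (at x)"
    by (rule derivative_eq_intros frame_derivatives refl)+
      (auto simp: h_frame h_deriv)
  have "2 * K x * fd K x u = \<alpha> * (2 * (\<gamma> u e1 e1 + \<gamma> u e2 e2 + \<gamma> u e3 e3))"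
    by (rule has_derivative_eq_on_open[OF U x _ L R]) (rule alternating_3_gram[OF \<psi> h dim \<psi>_norm])
  then have "K x * fd K x u = K x * (K x * (\<gamma> u e1 e1 + \<gamma> u e2 e2 + \<gamma> u e3 e3))"
    unfolding K_square[symmetric] power2_eq_square by algebra
  then show ?thesis using K_nonzero by simp
qed

lemma d_tau_frame: "d\<tau> x e2 e3 = 3 * K x * \<tau> x e1" "d\<tau> x e3 e1 = 3 * K x * \<tau> x e2" "d\<tau> x e1 e2 = 3 * K x * \<tau> x e3"
  unfolding curl_in_frame[OF x span_frame] by (simp_all add: h_frame)

lemma curl_derivative:
  "3 * (fd K x u * \<tau> x v + K x * fd (\<lambda>y. \<tau> y v) x u) =
    (\<gamma> u v e1 + \<gamma> u e1 v) * (3 * K x * \<tau> x e1) + h c x v e1 * fd (\<lambda>y. d\<tau> y e2 e3) x u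
    + (\<gamma> u v e2 + \<gamma> u e2 v) * (3 * K x * \<tau> x e2) + h c x v e2 * fd (\<lambda>y. d\<tau> y e3 e1) x u
    + (\<gamma> u v e3 + \<gamma> u e3 v) * (3 * K x * \<tau> x e3) + h c x v e3 * fd (\<lambda>y. d\<tau> y e1 e2) x u"
proof -
  have L: "((\<lambda>y. 3 * K y * \<tau> y v) has_derivative (\<lambda>u. 3 * (fd K x u * \<tau> x v + K x * fd (\<lambda>y. \<tau> y v) x u))) (at x)"
    by (rule derivative_eq_intros frame_derivatives refl)+ (auto simp: algebra_simps)
  have R: "((\<lambda>y. h c y v e1 * d\<tau> y e2 e3 + h c y v e2 * d\<tau> y e3 e1 + h c y v e3 * d\<tau> y e1 e2) has_derivative
    (\<lambda>u. (\<gamma> u v e1 + \<gamma> u e1 v) * (3 * K x * \<tau> x e1) + h c x v e1 * fd (\<lambda>y. d\<tau> y e2 e3) x u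
    + (\<gamma> u v e2 + \<gamma> u e2 v) * (3 * K x * \<tau> x e2) + h c x v e2 * fd (\<lambda>y. d\<tau> y e3 e1) x u
    + (\<gamma> u v e3 + \<gamma> u e3 v) * (3 * K x * \<tau> x e3) + h c x v e3 * fd (\<lambda>y. d\<tau> y e1 e2) x u)) (at x)"
    by (rule derivative_eq_intros frame_derivatives refl)+
      (auto simp: h_deriv d_tau_frame algebra_simps)
  show ?thesis
    by (rule has_derivative_eq_on_open[OF U x _ L R]) (rule curl_in_frame[OF _ span_frame])
qed

lemma d_d_tau_frame: "fd (\<lambda>y. d\<tau> y e2 e3) x e1 + fd (\<lambda>y. d\<tau> y e3 e1) x e2 + fd (\<lambda>y. d\<tau> y e1 e2) x e3 = 0"
  using ext_deriv_2_ext_deriv_1[OF U x \<tau>_smooth, where u=e1 and v=e2 and w=e3] by (simp add: ext_deriv_2_def)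

lemma tau_expansion: "\<tau> x u = h c x u e1 * \<tau> x e1 + h c x u e2 * \<tau> x e2 + h c x u e3 * \<tau> x e3"
  by (subst frame_expansion[of u])
    (simp add: linear_add[OF tau_linear[OF x]] linear_cmul[OF tau_linear[OF x]])

text \<open>Add up \<open>curl_derivative\<close> over \<open>u = v = e1, e2, e3\<close>. The derivatives of the components of \<open>d\<tau>\<close> add up
  to \<open>dd\<tau> = 0\<close>, and the derivatives of \<open>K\<close> cancel against the terms \<open>\<gamma> e\<^sub>i e\<^sub>j e\<^sub>i\<close>.\<close>

lemma divergence_frame:
  "(fd (\<lambda>y. \<tau> y e1) x e1 - \<tau> x (\<Gamma> e1 e1)) + (fd (\<lambda>y. \<tau> y e2) x e2 - \<tau> x (\<Gamma> e2 e2))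
    + (fd (\<lambda>y. \<tau> y e3) x e3 - \<tau> x (\<Gamma> e3 e3)) = 0" (is "?div = 0")
proof -
  have g: "\<gamma> e2 e1 w = \<gamma> e1 e2 w" "\<gamma> e3 e1 w = \<gamma> e1 e3 w" "\<gamma> e3 e2 w = \<gamma> e2 e3 w" for w
    by (rule gamma_sym)+
  have "3 * K x * ?div = 0"
    using curl_derivative[of e1 e1] curl_derivative[of e2 e2] curl_derivative[of e3 e3] d_d_tau_frame
    unfolding K_deriv h_frame tau_expansion[of "\<Gamma> _ _"] \<gamma>_def[symmetric] g
    by (simp add: algebra_simps)
  then show ?thesis using K_nonzero by simp
qed

lemma d_tau_expansion:
  "d\<tau> x u e3 = h c x u e2 * (3 * K x * \<tau> x e1) - h c x u e1 * (3 * K x * \<tau> x e2)"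
  "d\<tau> x e1 u = h c x u e2 * (3 * K x * \<tau> x e3) - h c x u e3 * (3 * K x * \<tau> x e2)"
  "d\<tau> x e2 u = h c x u e3 * (3 * K x * \<tau> x e1) - h c x u e1 * (3 * K x * \<tau> x e3)"
  "d\<tau> x e3 u = h c x u e1 * (3 * K x * \<tau> x e2) - h c x u e2 * (3 * K x * \<tau> x e1)"
proof -
  note l = linear_add[OF d_tau_linear(1)[OF x]] linear_cmul[OF d_tau_linear(1)[OF x]]
    linear_add[OF d_tau_linear(2)[OF x]] linear_cmul[OF d_tau_linear(2)[OF x]]
  have s: "d\<tau> x e1 e3 = - (3 * K x * \<tau> x e2)" "d\<tau> x e2 e1 = - (3 * K x * \<tau> x e3)" "d\<tau> x e3 e2 = - (3 * K x * \<tau> x e1)"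
    "d\<tau> x e1 e1 = 0" "d\<tau> x e2 e2 = 0" "d\<tau> x e3 e3 = 0"
    unfolding d_tau_frame[symmetric] by (simp_all add: ext_deriv_1_def)
  show "d\<tau> x u e3 = h c x u e2 * (3 * K x * \<tau> x e1) - h c x u e1 * (3 * K x * \<tau> x e2)"
    by (subst frame_expansion[of u]) (simp add: l s d_tau_frame)
  show "d\<tau> x e1 u = h c x u e2 * (3 * K x * \<tau> x e3) - h c x u e3 * (3 * K x * \<tau> x e2)"
    "d\<tau> x e2 u = h c x u e3 * (3 * K x * \<tau> x e1) - h c x u e1 * (3 * K x * \<tau> x e3)"
    "d\<tau> x e3 u = h c x u e1 * (3 * K x * \<tau> x e2) - h c x u e2 * (3 * K x * \<tau> x e1)"
    by (subst frame_expansion[of u]; simp add: l s d_tau_frame)+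
qed

text \<open>The left-hand side is \<open>\<delta>d\<tau>\<close> evaluated on \<open>e3\<close>. The antisymmetrised \<open>curl_derivative\<close> trades the
  derivatives of \<open>d\<tau>\<close> in it for \<open>3K d\<tau>(e1, e2)\<close>, which is \<open>9K\<^sup>2 \<tau>(e3)\<close>.\<close>

lemma codiff_curl_frame:
  "- ((fd (\<lambda>y. d\<tau> y e1 e3) x e1 - d\<tau> x (\<Gamma> e1 e1) e3 - d\<tau> x e1 (\<Gamma> e1 e3))
    + (fd (\<lambda>y. d\<tau> y e2 e3) x e2 - d\<tau> x (\<Gamma> e2 e2) e3 - d\<tau> x e2 (\<Gamma> e2 e3))
    + (fd (\<lambda>y. d\<tau> y e3 e3) x e3 - d\<tau> x (\<Gamma> e3 e3) e3 - d\<tau> x e3 (\<Gamma> e3 e3))) = 9 * \<alpha> * \<tau> x e3"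
proof -
  have g: "\<gamma> e2 e1 w = \<gamma> e1 e2 w" "\<gamma> e3 e1 w = \<gamma> e1 e3 w" "\<gamma> e3 e2 w = \<gamma> e2 e3 w" for w
    by (rule gamma_sym)+
  have f: "fd (\<lambda>y. d\<tau> y e1 e3) x e1 = - fd (\<lambda>y. d\<tau> y e3 e1) x e1" "fd (\<lambda>y. d\<tau> y e3 e3) x e3 = 0"
  proof -
    have "(\<lambda>y. d\<tau> y e1 e3) = (\<lambda>y. - d\<tau> y e3 e1)" "(\<lambda>y. d\<tau> y e3 e3) = (\<lambda>y. 0)"
      by (simp_all add: ext_deriv_1_def)
    then show "fd (\<lambda>y. d\<tau> y e1 e3) x e1 = - fd (\<lambda>y. d\<tau> y e3 e1) x e1" "fd (\<lambda>y. d\<tau> y e3 e3) x e3 = 0"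
      using fd_minus[OF smooth_on_differentiable[OF d_tau_smooth x]] by simp_all
  qed
  have t: "fd (\<lambda>y. \<tau> y e2) x e1 - fd (\<lambda>y. \<tau> y e1) x e2 = 3 * K x * \<tau> x e3"
    using d_tau_frame(3) by (simp add: ext_deriv_1_def)
  have a: "9 * \<alpha> * \<tau> x e3 = 3 * K x * (fd (\<lambda>y. \<tau> y e2) x e1 - fd (\<lambda>y. \<tau> y e1) x e2)"
    unfolding t K_square[symmetric] by (simp add: power2_eq_square)
  show ?thesis
    using curl_derivative[of e1 e2] curl_derivative[of e2 e1]
    unfolding a f d_tau_expansion K_deriv h_frame \<gamma>_def[symmetric] g
    by (simp add: algebra_simps)
qed

end

context
  fixes \<theta> :: "('l, 'f) form_field"
  assumes \<theta>: "\<And>y vs. \<theta> c y vs = (case vs of [u] \<Rightarrow> \<tau> y u | _ \<Rightarrow> 0)"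
begin

lemma theta_degree: "length vs \<noteq> 1 \<Longrightarrow> \<theta> c y vs = 0"
  by (auto simp: \<theta> split: list.split)

lemma ext_deriv_theta_degree: "length vs \<noteq> 2 \<Longrightarrow> ext_deriv \<theta> c y vs = 0"
  unfolding ext_deriv_def by (rule sum.neutral) (auto simp: theta_degree)

lemma ext_deriv_theta: "ext_deriv \<theta> c y [u, v] = d\<tau> y u v"
  by (simp add: ext_deriv_def ext_deriv_1_def \<theta> numeral_2_eq_2)

text \<open>Taking the basis chosen in the definition of \<open>codiff\<close> as the frame makes \<open>codiff\<close> a sum of three explicit
  terms.\<close>

lemma codiff_sum:
  assumes y: "y \<in> U"
  obtains e1 e2 e3 where "orthonormal_basis (h c y) {e1, e2, e3}" "e1 \<noteq> e2" "e1 \<noteq> e3" "e2 \<noteq> e3"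
    "\<And>\<eta> vs. codiff h \<eta> c y vs = - (cov_deriv_form h \<eta> c y e1 (e1 # vs)
      + cov_deriv_form h \<eta> c y e2 (e2 # vs) + cov_deriv_form h \<eta> c y e3 (e3 # vs))"
proof -
  let ?B = "SOME B. orthonormal_basis (h c y) B"
  have B: "orthonormal_basis (h c y) ?B" by (rule someI_ex[OF orthonormal_basis_exists[OF h[OF y]]])
  have "card ?B = 3" using orthonormal_basis_card[OF h_bilinear[OF y] B] dim by simp
  then obtain a1 a2 a3 where a: "?B = {a1, a2, a3}" "a1 \<noteq> a2" "a1 \<noteq> a3" "a2 \<noteq> a3"
    unfolding card_3_iff by auto
  show ?thesis
  proof (rule that)
    show "orthonormal_basis (h c y) {a1, a2, a3}" using B unfolding a(1) .
    show "a1 \<noteq> a2" "a1 \<noteq> a3" "a2 \<noteq> a3" using a by simp_all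
    show "codiff h \<eta> c y vs = - (cov_deriv_form h \<eta> c y a1 (a1 # vs)
      + cov_deriv_form h \<eta> c y a2 (a2 # vs) + cov_deriv_form h \<eta> c y a3 (a3 # vs))" for \<eta> vs
      unfolding codiff_def a(1) using a(2-4) by simp
  qed
qed

lemma cov_deriv_form_zero:
  assumes y: "y \<in> U" and \<eta>: "\<And>z ws. z \<in> U \<Longrightarrow> length ws = length vs \<Longrightarrow> \<eta> c z ws = 0"
  shows "cov_deriv_form h \<eta> c y u vs = 0"
proof -
  have "fd (\<lambda>z. \<eta> c z vs) y = fd (\<lambda>z. 0) y"
    by (rule fd_cong[OF U y]) (simp add: \<eta>)
  then show ?thesis using \<eta>[OF y] by (simp add: cov_deriv_form_def)
qed

lemma coclosed:
  assumes y: "y \<in> U" shows "codiff h \<theta> c y vs = 0"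
proof -
  obtain e1 e2 e3 where e: "orthonormal_basis (h c y) {e1, e2, e3}" "e1 \<noteq> e2" "e1 \<noteq> e3" "e2 \<noteq> e3"
    "codiff h \<theta> c y vs = - (cov_deriv_form h \<theta> c y e1 (e1 # vs)
      + cov_deriv_form h \<theta> c y e2 (e2 # vs) + cov_deriv_form h \<theta> c y e3 (e3 # vs))"
    by (rule codiff_sum[OF y]) blast
  show ?thesis
  proof (cases vs)
    case Nil
    have "cov_deriv_form h \<theta> c y a [a] = fd (\<lambda>z. \<tau> z a) y a - \<tau> y (christoffel h c y a a)" for a
      by (simp add: cov_deriv_form_def \<theta>)
    then show ?thesis using e(5) divergence_frame[OF y e(1-4)] Nil by simp
  next
    case (Cons u us)
    then have "cov_deriv_form h \<theta> c y a (a # vs) = 0" for a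
      by (intro cov_deriv_form_zero[OF y]) (simp add: theta_degree)
    then show ?thesis using e(5) by simp
  qed
qed

text \<open>The frame computation covers the last vector of an orthonormal frame. Rotating the frame cyclically gives
  all three, and both sides are linear.\<close>

lemma codiff_ext_deriv:
  assumes x: "x \<in> U" shows "codiff h (ext_deriv \<theta>) c x vs = 9 * \<alpha> * \<theta> c x vs"
proof -
  obtain e1 e2 e3 where e: "orthonormal_basis (h c x) {e1, e2, e3}" "e1 \<noteq> e2" "e1 \<noteq> e3" "e2 \<noteq> e3"
    "\<And>vs. codiff h (ext_deriv \<theta>) c x vs = - (cov_deriv_form h (ext_deriv \<theta>) c x e1 (e1 # vs)
      + cov_deriv_form h (ext_deriv \<theta>) c x e2 (e2 # vs) + cov_deriv_form h (ext_deriv \<theta>) c x e3 (e3 # vs))"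
    by (rule codiff_sum[OF x]) blast
  show ?thesis
  proof (cases "length vs = 1")
    case False
    then have "cov_deriv_form h (ext_deriv \<theta>) c x a (a # vs) = 0" for a
      by (intro cov_deriv_form_zero[OF x]) (simp add: ext_deriv_theta_degree)
    then show ?thesis using False e(5) by (simp add: theta_degree)
  next
    case True
    then obtain u where vs: "vs = [u]" by (auto simp: length_Suc_conv)
    let ?\<Gamma> = "christoffel h c x"
    have bil: "bilinear ?\<Gamma>"
      using christoffel_eqs(1)[OF U x, of h] h_bilinear h_sym h[OF x] smooth_on_differentiable[OF h_smooth x]
      unfolding inner_form_def by auto
    define q where "q a v = fd (\<lambda>y. d\<tau> y a v) x a - d\<tau> x (?\<Gamma> a a) v - d\<tau> x a (?\<Gamma> a v)" for a v
    have q: "cov_deriv_form h (ext_deriv \<theta>) c x a [a, v] = q a v" for a v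
      by (simp add: cov_deriv_form_def ext_deriv_theta q_def numeral_2_eq_2)
    have q_linear: "linear (q a)" for a
    proof -
      have l: "linear (\<lambda>v. fd (\<lambda>y. d\<tau> y a v) x a)"
        by (rule fd_linear_field[OF U x d_tau_linear(2) smooth_on_differentiable[OF d_tau_smooth x]])
      show ?thesis
        by (rule linearI)
          (simp_all add: q_def linear_add[OF l] linear_cmul[OF l] linear_add[OF d_tau_linear(2)[OF x]]
            linear_cmul[OF d_tau_linear(2)[OF x]] bilinear_radd[OF bil] bilinear_rmul[OF bil] algebra_simps)
    qed
    \<comment> \<open>Cyclic rotations of the frame, to bring each of the three vectors to the last place.\<close>
    have e': "orthonormal_basis (h c x) {e2, e3, e1}" "orthonormal_basis (h c x) {e3, e1, e2}"
      using e(1) by (simp_all add: insert_commute)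
    have "- (q e1 v + q e2 v + q e3 v) = 9 * \<alpha> * \<tau> x v" if "v \<in> {e1, e2, e3}" for v
      using that codiff_curl_frame[OF x e(1-4)]
        codiff_curl_frame[OF x e'(1) e(4) e(2)[symmetric] e(3)[symmetric]]
        codiff_curl_frame[OF x e'(2) e(3)[symmetric] e(4)[symmetric] e(2)]
      unfolding q_def[symmetric] by auto
    note on_frame = this
    have lin: "linear (\<lambda>v. - (q e1 v + q e2 v + q e3 v))" "linear (\<lambda>v. 9 * \<alpha> * \<tau> x v)"
      by (rule linearI; simp add: linear_add[OF q_linear] linear_cmul[OF q_linear] linear_add[OF tau_linear[OF x]]
          linear_cmul[OF tau_linear[OF x]] algebra_simps)+
    have "u \<in> span {e1, e2, e3}" using e(1) by (simp add: orthonormal_basis_def)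
    from linear_eq_on_span[OF lin on_frame this]
    have "- (q e1 u + q e2 u + q e3 u) = 9 * \<alpha> * \<tau> x u" .
    then show ?thesis unfolding e(5) vs q \<theta> by simp
  qed
qed

lemma hodge_laplacian_eigenform:
  assumes x: "x \<in> U" shows "hodge_laplacian h \<theta> c x vs = 9 * \<alpha> * \<theta> c x vs"
proof -
  have "fd (\<lambda>y. codiff h \<theta> c y ws) x = fd (\<lambda>y. 0) x" for ws
    by (rule fd_cong[OF U x]) (rule coclosed)
  then have "ext_deriv (codiff h \<theta>) c x vs = 0" by (simp add: ext_deriv_def)
  then show ?thesis by (simp add: hodge_laplacian_def codiff_ext_deriv[OF x])
qed

end

end

section \<open>Variations in charts\<close>

lemma smooth_on_slice:
  fixes f :: "'a::euclidean_space \<times> 'b::euclidean_space \<Rightarrow> 'c::real_normed_vector"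
  assumes N: "open N" and U: "open U" "\<And>x. x \<in> U \<Longrightarrow> (t, x) \<in> N" and f: "smooth_on N f"
  shows "smooth_on U (\<lambda>x. f (t, x))"
proof -
  have "bounded_linear (\<lambda>x :: 'b. (0 :: 'a, x))"
    by (rule bounded_linear_Pair[OF bounded_linear_zero bounded_linear_ident])
  then have "smooth_on U (\<lambda>x. (t, 0) + (0, x))"
    using smooth_on_add[OF U(1) smooth_on_const smooth_on_linear] by blast
  then have "smooth_on U (\<lambda>x. (t, x))" by simp
  from smooth_on_compose[OF U(1) N this f] show ?thesis using U(2) by auto
qed

lemma fd_slice:
  assumes "f differentiable (at (t, x))"
  shows "fd (\<lambda>x. f (t, x)) x u = fd f (t, x) (0, u)"
proof -
  have "((\<lambda>x. (t, x)) has_derivative (\<lambda>u. (0, u))) (at x)"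
    by (auto intro!: derivative_eq_intros)
  from diff_chain_at[OF this fd_has_derivative[OF assms]] show ?thesis
    by (simp add: o_def fd_eqI)
qed

lemma vector_derivative_slice:
  assumes "f differentiable (at (t, x))"
  shows "vector_derivative (\<lambda>s. f (s, x)) (at t) = fd f (t, x) (1, 0)"
proof -
  have "((\<lambda>s. (s, x)) has_derivative (\<lambda>k. (k, 0))) (at t)"
    by (auto intro!: derivative_eq_intros)
  from diff_chain_at[OF this fd_has_derivative[OF assms]]
  have "((\<lambda>s. f (s, x)) has_derivative (\<lambda>k. fd f (t, x) (k, 0))) (at t)"
    by (simp add: o_def)
  moreover have "(\<lambda>k. fd f (t, x) (k, 0)) = (\<lambda>k. k *\<^sub>R fd f (t, x) (1, 0))"
  proof
    show "fd f (t, x) (k, 0) = k *\<^sub>R fd f (t, x) (1, 0)" for k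
      using linear_cmul[OF linear_frechet_derivative[OF assms], of k "(1, 0)"] by simp
  qed
  ultimately have "((\<lambda>s. f (s, x)) has_vector_derivative fd f (t, x) (1, 0)) (at t)"
    unfolding has_vector_derivative_def by simp
  then show ?thesis by (rule vector_derivative_at)
qed

lemma chart_inv_map: "topological_chart c \<Longrightarrow> p \<in> chart_dom c \<Longrightarrow> chart_inv c (chart_map c p) = p"
  by (simp add: topological_chart_def homeomorphism_def)

lemma chart_map_inv: "topological_chart c \<Longrightarrow> x \<in> chart_image c \<Longrightarrow> chart_map c (chart_inv c x) = x"
  by (simp add: topological_chart_def homeomorphism_def)

lemma chart_inv_dom: "topological_chart c \<Longrightarrow> x \<in> chart_image c \<Longrightarrow> chart_inv c x \<in> chart_dom c"
  unfolding topological_chart_def homeomorphism_def by blast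

lemma smooth_manifold_chart: "smooth_manifold A \<Longrightarrow> c \<in> A \<Longrightarrow> topological_chart c"
  by (simp add: smooth_manifold_def)

lemma chart_at_contains: "p \<in> points A \<Longrightarrow> chart_at A p \<in> A \<and> p \<in> chart_dom (chart_at A p)"
  unfolding chart_at_def points_def by (rule someI_ex) auto

text \<open>The transformation law alone, which \<open>kaehler_form\<close> shares with the metric.\<close>

definition tensorial :: "('m, 'e::euclidean_space) chart set \<Rightarrow> ('m, 'e) bilinear_field \<Rightarrow> bool" where
  "tensorial A b \<longleftrightarrow> (\<forall>c\<in>A. \<forall>d\<in>A. \<forall>p \<in> chart_dom c \<inter> chart_dom d. \<forall>u v.
     b c (chart_map c p) u v =
     b d (chart_map d p) (local_diff c d id (chart_map c p) u) (local_diff c d id (chart_map c p) v))"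

lemma tensorial_metric: "almost_hermitian A J g \<Longrightarrow> tensorial A g"
  unfolding tensorial_def almost_hermitian_def riemannian_metric_def smooth_bilinear_field_def
  by (elim conjE)

lemma tensorial_kaehler_form:
  assumes "almost_hermitian A J g" shows "tensorial A (kaehler_form J g)"
proof -
  have "smooth_endo_field A J" using assms by (simp add: almost_hermitian_def)
  then have J: "J d (chart_map d p) (local_diff c d id (chart_map c p) u) =
      local_diff c d id (chart_map c p) (J c (chart_map c p) u)"
    if "c \<in> A" "d \<in> A" "p \<in> chart_dom c \<inter> chart_dom d" for c d p u
    using that unfolding smooth_endo_field_def by metis
  have g: "g c (chart_map c p) u v =
      g d (chart_map d p) (local_diff c d id (chart_map c p) u) (local_diff c d id (chart_map c p) v)"
    if "c \<in> A" "d \<in> A" "p \<in> chart_dom c \<inter> chart_dom d" for c d p u v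
    using tensorial_metric[OF assms] that unfolding tensorial_def by blast
  show ?thesis
    unfolding tensorial_def kaehler_form_def
  proof (intro ballI allI)
    fix c d p u v assume "c \<in> A" "d \<in> A" "p \<in> chart_dom c \<inter> chart_dom d"
    note cdp = this
    show "g c (chart_map c p) (J c (chart_map c p) u) v =
       g d (chart_map d p) (J d (chart_map d p) (local_diff c d id (chart_map c p) u)) (local_diff c d id (chart_map c p) v)"
      unfolding J[OF cdp] by (rule g[OF cdp])
  qed
qed

locale manifold_variation =
  fixes M :: "('m::{t2_space, second_countable_topology}, 'e::euclidean_space) chart set"
    and L :: "('l::{t2_space, second_countable_topology}, 'f::euclidean_space) chart set"
    and F :: "real \<Rightarrow> 'l \<Rightarrow> 'm" and \<epsilon> :: real
  assumes M: "smooth_manifold M" and L: "smooth_manifold L" and F: "smooth_variation L M \<epsilon> F"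
begin

text \<open>The whole variation in charts \<open>c\<close> of \<open>L\<close> and \<open>d\<close> of \<open>M\<close>, time being the first coordinate.\<close>

definition rep :: "('l, 'f) chart \<Rightarrow> ('m, 'e) chart \<Rightarrow> real \<times> 'f \<Rightarrow> 'e" where
  "rep c d = (\<lambda>(s, x). chart_map d (F s (chart_inv c x)))"

definition rep_dom :: "('l, 'f) chart \<Rightarrow> ('m, 'e) chart \<Rightarrow> (real \<times> 'f) set" where
  "rep_dom c d = {(s, x). s \<in> {-\<epsilon><..<\<epsilon>} \<and> x \<in> chart_image c \<and> F s (chart_inv c x) \<in> chart_dom d}"

lemma variation_continuous: "continuous_on ({-\<epsilon><..<\<epsilon>} \<times> points L) (\<lambda>(s, p). F s p)"
  and variation_range: "s \<in> {-\<epsilon><..<\<epsilon>} \<Longrightarrow> p \<in> points L \<Longrightarrow> F s p \<in> points M"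
proof -
  have "points (prod_atlas (interval_atlas (-\<epsilon>) \<epsilon>) L) = {-\<epsilon><..<\<epsilon>} \<times> points L"
    by (auto simp: points_def prod_atlas_def interval_atlas_def)
  then have "continuous_on ({-\<epsilon><..<\<epsilon>} \<times> points L) (\<lambda>(s, p). F s p)"
    and "(\<lambda>(s, p). F s p) ` ({-\<epsilon><..<\<epsilon>} \<times> points L) \<subseteq> points M"
    using F unfolding smooth_variation_def smooth_map_def by metis+
  then show "continuous_on ({-\<epsilon><..<\<epsilon>} \<times> points L) (\<lambda>(s, p). F s p)"
    "s \<in> {-\<epsilon><..<\<epsilon>} \<Longrightarrow> p \<in> points L \<Longrightarrow> F s p \<in> points M"
    by fast+
qed

context
  fixes c d assumes c: "c \<in> L" and d: "d \<in> M"
begin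

lemma rep_dom_open: "open (rep_dom c d)"
proof -
  have tc: "topological_chart c" "topological_chart d"
    using smooth_manifold_chart[OF L c] smooth_manifold_chart[OF M d] .
  have dom: "chart_inv c ` chart_image c \<subseteq> points L"
    using chart_inv_dom[OF tc(1)] c by (auto simp: points_def)
  have "continuous_on (chart_image c) (chart_inv c)"
    using tc(1) by (simp add: topological_chart_def homeomorphism_def)
  then have "continuous_on ({-\<epsilon><..<\<epsilon>} \<times> chart_image c) (\<lambda>z. chart_inv c (snd z))"
    by (rule continuous_on_compose2[OF _ continuous_on_snd[OF continuous_on_id]]) auto
  from continuous_on_Pair[OF continuous_on_fst[OF continuous_on_id] this]
  have "continuous_on ({-\<epsilon><..<\<epsilon>} \<times> chart_image c) (\<lambda>z. (\<lambda>(s, p). F s p) (fst z, chart_inv c (snd z)))"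
    by (rule continuous_on_compose2[OF variation_continuous]) (use dom in auto)
  moreover have "open ({-\<epsilon><..<\<epsilon>} \<times> chart_image c)" "open (chart_dom d)"
    using tc by (simp_all add: topological_chart_def open_Times)
  ultimately have "open (({-\<epsilon><..<\<epsilon>} \<times> chart_image c) \<inter> (\<lambda>z. (\<lambda>(s, p). F s p) (fst z, chart_inv c (snd z))) -` chart_dom d)"
    by (rule continuous_open_preimage)
  moreover have "({-\<epsilon><..<\<epsilon>} \<times> chart_image c) \<inter> (\<lambda>z. (\<lambda>(s, p). F s p) (fst z, chart_inv c (snd z))) -` chart_dom d
      = rep_dom c d"
    by (auto simp: rep_dom_def)
  ultimately show ?thesis by simp
qed

lemma rep_smooth: "smooth_on (rep_dom c d) (rep c d)"
proof -
  have tc: "topological_chart c" by (rule smooth_manifold_chart[OF L c])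
  let ?C = "Chart ({-\<epsilon><..<\<epsilon>} \<times> chart_dom c) (map_prod id (chart_map c))"
  have "?C \<in> prod_atlas (interval_atlas (-\<epsilon>) \<epsilon>) L"
    using c by (auto simp: prod_atlas_def interval_atlas_def)
  then have "smooth_on (chart_map ?C ` (chart_dom ?C \<inter> (\<lambda>(t, p). F t p) -` chart_dom d)) (local_rep ?C d (\<lambda>(t, p). F t p))"
    using F d unfolding smooth_variation_def smooth_map_def by blast
  moreover have "chart_map ?C ` (chart_dom ?C \<inter> (\<lambda>(t, p). F t p) -` chart_dom d) = rep_dom c d"
  proof (intro equalityI subsetI)
    fix z assume "z \<in> chart_map ?C ` (chart_dom ?C \<inter> (\<lambda>(t, p). F t p) -` chart_dom d)"
    then show "z \<in> rep_dom c d"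
      using chart_inv_map[OF tc] by (auto simp: rep_dom_def chart_image_def)
  next
    fix z assume "z \<in> rep_dom c d"
    then obtain s x where z: "z = (s, x)" "s \<in> {-\<epsilon><..<\<epsilon>}" "x \<in> chart_image c" "F s (chart_inv c x) \<in> chart_dom d"
      by (auto simp: rep_dom_def)
    then show "z \<in> chart_map ?C ` (chart_dom ?C \<inter> (\<lambda>(t, p). F t p) -` chart_dom d)"
      using chart_inv_dom[OF tc z(3)] chart_map_inv[OF tc z(3)]
      by (intro image_eqI[of _ _ "(s, chart_inv c x)"]) auto
  qed
  ultimately have "smooth_on (rep_dom c d) (local_rep ?C d (\<lambda>(t, p). F t p))" by simp
  then show ?thesis
  proof (rule smooth_on_cong[OF rep_dom_open])
    fix z assume "z \<in> rep_dom c d"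
    then obtain s x where z: "z = (s, x)" "s \<in> {-\<epsilon><..<\<epsilon>}" "x \<in> chart_image c"
      by (auto simp: rep_dom_def)
    \<comment> \<open>The inverse of a product chart is computed componentwise.\<close>
    have "inj_on (chart_map c) (chart_dom c)"
      using chart_inv_map[OF tc] by (rule inj_on_inverseI)
    then have "inj_on (map_prod id (chart_map c)) ({-\<epsilon><..<\<epsilon>} \<times> chart_dom c)"
      by (intro map_prod_inj_on) auto
    then have "chart_inv ?C z = (s, chart_inv c x)"
      unfolding chart_inv_def[of ?C] chart.sel
      by (rule inv_into_f_eq) (use z chart_inv_dom[OF tc z(3)] chart_map_inv[OF tc z(3)] in auto)
    then show "local_rep ?C d (\<lambda>(t, p). F t p) z = rep c d z"
      by (simp add: local_rep_def rep_def z)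
  qed
qed

lemma rep_image: "rep c d ` rep_dom c d \<subseteq> chart_image d"
  by (auto simp: rep_def rep_dom_def chart_image_def)

context
  fixes s x assumes sx: "(s, x) \<in> rep_dom c d"
begin

lemma rep_differentiable: "rep c d differentiable (at (s, x))"
  by (rule smooth_on_differentiable[OF rep_smooth sx])

lemma local_rep_variation: "local_rep c d (F s) x = rep c d (s, x)"
  by (simp add: local_rep_def rep_def)

lemma local_diff_variation: "local_diff c d (F s) x u = fd (rep c d) (s, x) (0, u)"
  using fd_slice[OF rep_differentiable, of u] by (simp add: local_diff_def local_rep_def rep_def o_def)

lemma variation_field_variation: "variation_field d F s (chart_inv c x) = fd (rep c d) (s, x) (1, 0)"
  using vector_derivative_slice[OF rep_differentiable] by (simp add: variation_field_def rep_def)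

end

end

lemma rep_chart_change:
  assumes "c \<in> L" "d \<in> M" "d' \<in> M" "z \<in> rep_dom c d" "z \<in> rep_dom c d'"
  shows "fd (rep c d') z v = local_diff d d' id (rep c d z) (fd (rep c d) z v)"
proof -
  have td: "topological_chart d" by (rule smooth_manifold_chart[OF M assms(2)])
  let ?N = "rep_dom c d \<inter> rep_dom c d'"
  have eq: "rep c d' y = local_rep d d' id (rep c d y)" if "y \<in> ?N" for y
    using that by (auto simp: rep_dom_def rep_def local_rep_def chart_inv_map[OF td])
  have "rep c d z \<in> chart_map d ` (chart_dom d \<inter> chart_dom d')"
    using assms(4,5) by (auto simp: rep_dom_def rep_def)
  then have "local_rep d d' id differentiable (at (rep c d z))"
    using M assms(2,3) unfolding smooth_manifold_def by (blast intro: smooth_on_differentiable)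
  moreover have "rep c d differentiable (at z)"
    by (rule smooth_on_differentiable[OF rep_smooth assms(4)]) (use assms in auto)
  ultimately have "fd (\<lambda>y. local_rep d d' id (rep c d y)) z v = fd (local_rep d d' id) (rep c d z) (fd (rep c d) z v)"
    by (intro fd_compose)
  moreover have "fd (rep c d') z = fd (\<lambda>y. local_rep d d' id (rep c d y)) z"
    by (rule fd_cong[of ?N]) (use eq assms rep_dom_open in auto)
  ultimately show ?thesis by (simp add: local_diff_def)
qed

text \<open>In \<open>pullback\<close> and \<open>variation_form\<close> the chart of \<open>M\<close> is chosen anew at every point. By the transformation
  law, the results are the same in a fixed chart \<open>d\<close>, where they can be differentiated.\<close>

lemma pullback_chart:
  assumes b: "tensorial M b" and c: "c \<in> L" and d: "d \<in> M" and sx: "(s, x) \<in> rep_dom c d"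
  shows "pullback M (F s) b c x u v = b d (rep c d (s, x)) (fd (rep c d) (s, x) (0, u)) (fd (rep c d) (s, x) (0, v))"
    and "b (chart_at M (F s (chart_inv c x))) (chart_map (chart_at M (F s (chart_inv c x))) (F s (chart_inv c x)))
      (variation_field (chart_at M (F s (chart_inv c x))) F s (chart_inv c x))
      (local_diff c (chart_at M (F s (chart_inv c x))) (F s) x u)
      = b d (rep c d (s, x)) (fd (rep c d) (s, x) (1, 0)) (fd (rep c d) (s, x) (0, u))"
proof -
  let ?p = "F s (chart_inv c x)"
  let ?d = "chart_at M ?p"
  have "chart_inv c x \<in> chart_dom c"
    using chart_inv_dom[OF smooth_manifold_chart[OF L c]] sx by (auto simp: rep_dom_def)
  then have "?p \<in> points M" using sx c by (intro variation_range) (auto simp: rep_dom_def points_def)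
  from chart_at_contains[OF this] have d': "?d \<in> M" "?p \<in> chart_dom ?d" by simp_all
  then have sx': "(s, x) \<in> rep_dom c ?d" using sx by (auto simp: rep_dom_def)
  have p: "?p \<in> chart_dom d \<inter> chart_dom ?d" using sx d' by (auto simp: rep_dom_def)
  have r: "rep c d (s, x) = chart_map d ?p" "rep c ?d (s, x) = chart_map ?d ?p"
    by (simp_all add: rep_def)
  note change = rep_chart_change[OF c d d'(1) sx sx', unfolded r]
  have tens: "b ?d (chart_map ?d ?p) (local_diff d ?d id (chart_map d ?p) a) (local_diff d ?d id (chart_map d ?p) a')
     = b d (chart_map d ?p) a a'" for a a'
    by (rule b[unfolded tensorial_def, rule_format, OF d d'(1) p, symmetric])
  show "pullback M (F s) b c x u v = b d (rep c d (s, x)) (fd (rep c d) (s, x) (0, u)) (fd (rep c d) (s, x) (0, v))"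
    unfolding pullback_def Let_def local_diff_variation[OF c d'(1) sx'] local_rep_variation[OF c d'(1) sx'] r change tens ..
  show "b ?d (chart_map ?d ?p) (variation_field ?d F s (chart_inv c x)) (local_diff c ?d (F s) x u)
      = b d (rep c d (s, x)) (fd (rep c d) (s, x) (1, 0)) (fd (rep c d) (s, x) (0, u))"
    unfolding local_diff_variation[OF c d'(1) sx'] variation_field_variation[OF c d'(1) sx'] r change tens ..
qed

end

section \<open>Lagrangian variations\<close>

lemma smooth_on_trilinear_field:
  fixes T :: "'a::real_normed_vector \<Rightarrow> 'b::euclidean_space \<Rightarrow> 'b \<Rightarrow> 'b \<Rightarrow> real"
  assumes U: "open U" and T: "\<And>y. y \<in> U \<Longrightarrow> alternating_3 (T y)"
    and sm: "\<And>u v w. smooth_on U (\<lambda>y. T y u v w)"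
    and a: "smooth_on U a" and b: "smooth_on U b" and c: "smooth_on U c"
  shows "smooth_on U (\<lambda>y. T y (a y) (b y) (c y))"
proof -
  have "smooth_on U (\<lambda>y. T y (a y) v w)" for v w
    by (rule smooth_on_linear_field[OF U, of "\<lambda>y u. T y u v w"])
      (rule alternating_3_linear[OF T] sm a | assumption)+
  then show ?thesis
    using smooth_on_bilinear_field[OF U, of "\<lambda>y. T y (a y)", OF _ _ b c]
      alternating_3_linear2[OF T] alternating_3_linear3[OF T]
    unfolding bilinear_def by blast
qed

locale lagrangian_variation = manifold_variation M L F \<epsilon>
  for M :: "('m::{t2_space, second_countable_topology}, 'e::euclidean_space) chart set"
    and L :: "('l::{t2_space, second_countable_topology}, 'f::euclidean_space) chart set"
    and F :: "real \<Rightarrow> 'l \<Rightarrow> 'm" and \<epsilon> :: real +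
  fixes J :: "('m, 'e) endo_field" and g :: "('m, 'e) bilinear_field" and \<alpha> :: real
  assumes dim: "DIM('e) = 6" and nk: "nearly_kaehler M J g" and type: "type_constant M J g \<alpha>"
    and lagrangian: "\<And>s. s \<in> {-\<epsilon><..<\<epsilon>} \<Longrightarrow> lagrangian_immersion L M J g (F s)"
begin

lemma almost_hermitian: "almost_hermitian M J g"
  using nk by (simp add: nearly_kaehler_def)

context
  fixes c d assumes c: "c \<in> L" and d: "d \<in> M"
begin

interpretation nk: nearly_kaehler_chart M J g d
  by unfold_locales (use nk d smooth_manifold_chart[OF M d] in \<open>simp_all add: topological_chart_def\<close>)

abbreviation "N \<equiv> rep_dom c d"
abbreviation "f \<equiv> rep c d"
abbreviation "Df z v \<equiv> fd (rep c d) z v"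

text \<open>\<open>\<Omega>\<close> is the pullback of \<open>\<omega>\<close> to space-time, and \<open>\<Psi>\<close> the three-form \<open>\<sigma>(JX, Y, Z)\<close> on the time slices. Vectors
  \<open>(0, u)\<close> are tangent to the slices.\<close>

definition "\<Omega> z a b = nk.\<omega> (f z) (Df z a) (Df z b)"
definition "\<Psi> z u v w = nk.\<sigma> (f z) (J d (f z) (Df z (0, u))) (Df z (0, v)) (Df z (0, w))"

lemma N_open: "open N" and f_smooth: "smooth_on N f" and f_image: "z \<in> N \<Longrightarrow> f z \<in> chart_image d"
  using rep_dom_open[OF c d] rep_smooth[OF c d] rep_image[OF c d] by auto

lemma Df_linear: "z \<in> N \<Longrightarrow> linear (Df z)"
  by (rule linear_frechet_derivative[OF smooth_on_differentiable[OF f_smooth]])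

lemma sigma_alternating: "y \<in> chart_image d \<Longrightarrow> alternating_3 (nk.\<sigma> y)"
  unfolding alternating_3_def using nk.sigma_linear nk.sigma_skew12 nk.sigma_skew23 by blast

text \<open>The definition of \<open>\<sigma>\<close> involves Christoffel symbols, whose smoothness is not obvious; as \<open>d\<omega>/3\<close> it has
  visibly smooth components.\<close>

lemma sigma_smooth: "smooth_on (chart_image d) (\<lambda>y. nk.\<sigma> y u v w)"
proof -
  have "smooth_on (chart_image d) (\<lambda>y. (1 / 3) * ext_deriv_2 nk.\<omega> y u v w)"
    unfolding ext_deriv_2_def
    by (intro smooth_on_mult smooth_on_add nk.open_image smooth_on_fd nk.omega_smooth smooth_on_const)
  then show ?thesis
    by (rule smooth_on_cong[OF nk.open_image]) (simp add: nk.ext_deriv_omega)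
qed

lemma pulled_back_smooth:
  assumes "smooth_on (chart_image d) b" shows "smooth_on N (\<lambda>z. b (f z))"
  using smooth_on_compose[OF N_open nk.open_image f_smooth assms rep_image[OF c d]] .

lemma Omega_smooth: "smooth_on N (\<lambda>z. \<Omega> z a b)"
  unfolding \<Omega>_def
proof (rule smooth_on_bilinear_field[OF N_open, of "\<lambda>z. nk.\<omega> (f z)"])
  show "bilinear (nk.\<omega> (f z))" if "z \<in> N" for z by (rule nk.omega_bilinear[OF f_image[OF that]])
qed (rule pulled_back_smooth[OF nk.omega_smooth] smooth_on_fd[OF f_smooth])+

lemma Psi_smooth: "smooth_on N (\<lambda>z. \<Psi> z u v w)"
proof -
  have "smooth_on N (\<lambda>z. J d (f z) (Df z (0, u)))"
  proof (rule smooth_on_linear_field[OF N_open, of "\<lambda>z. J d (f z)"])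
    show "linear (J d (f z))" if "z \<in> N" for z by (rule nk.J_linear[OF f_image[OF that]])
  qed (rule pulled_back_smooth[OF nk.J_smooth] smooth_on_fd[OF f_smooth])+
  from smooth_on_trilinear_field[OF N_open sigma_alternating[OF f_image] pulled_back_smooth[OF sigma_smooth]
      this smooth_on_fd[OF f_smooth] smooth_on_fd[OF f_smooth]]
  show ?thesis unfolding \<Psi>_def .
qed

lemma Omega_tangent:
  assumes "(s, x) \<in> N" shows "\<Omega> (s, x) (0, u) (0, v) = 0"
proof -
  have s: "s \<in> {-\<epsilon><..<\<epsilon>}" and x: "x \<in> chart_image c" using assms by (auto simp: rep_dom_def)
  have "pullback M (F s) (kaehler_form J g) c x u v = 0"
    using lagrangian[OF s] c x unfolding lagrangian_immersion_def by blast
  then show ?thesis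
    using pullback_chart(1)[OF tensorial_kaehler_form[OF almost_hermitian] c d assms, of u v] by (simp add: \<Omega>_def)
qed

lemma ext_deriv_Omega:
  assumes z: "z \<in> N"
  shows "ext_deriv_2 \<Omega> z a b e = 3 * nk.\<sigma> (f z) (Df z a) (Df z b) (Df z e)"
proof -
  have "\<Omega> = (\<lambda>z u v. nk.\<omega> (f z) (Df z u) (Df z v))" by (intro ext) (simp add: \<Omega>_def)
  then have "ext_deriv_2 \<Omega> z a b e = ext_deriv_2 nk.\<omega> (f z) (Df z a) (Df z b) (Df z e)"
    using ext_deriv_2_pullback[OF N_open z nk.open_image f_smooth rep_image[OF c d] nk.omega_bilinear
        nk.omega_skew nk.omega_smooth, of a b e] by simp
  then show ?thesis by (simp add: nk.ext_deriv_omega[OF f_image[OF z]])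
qed

text \<open>Every immersion of the family is Lagrangian, so this holds for the time direction \<open>a = (1, 0)\<close> as well.\<close>

lemma fd_Omega_tangent:
  assumes "z \<in> N" shows "fd (\<lambda>z. \<Omega> z (0, u) (0, v)) z a = 0"
proof -
  have "fd (\<lambda>z. \<Omega> z (0, u) (0, v)) z = fd (\<lambda>z. 0) z"
    by (rule fd_cong[OF N_open assms]) (metis Omega_tangent prod.collapse)
  then show ?thesis by simp
qed

lemma sigma_tangent:
  assumes z: "z \<in> N" shows "nk.\<sigma> (f z) (Df z (0, u)) (Df z (0, v)) (Df z (0, w)) = 0"
  using ext_deriv_Omega[OF z, of "(0, u)" "(0, v)" "(0, w)"]
  by (simp add: ext_deriv_2_def fd_Omega_tangent[OF z])

lemma tangent_space_lagrangian:
  assumes z: "(s, x) \<in> N"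
  shows "lagrangian_subspace (g d (f (s, x))) (J d (f (s, x))) (nk.S (f (s, x))) (nk.\<sigma> (f (s, x))) \<alpha>
    (\<lambda>u. Df (s, x) (0, u))"
proof -
  have s: "s \<in> {-\<epsilon><..<\<epsilon>}" and x: "x \<in> chart_image c" and p: "F s (chart_inv c x) \<in> chart_dom d"
    using z by (auto simp: rep_dom_def)
  note y = f_image[OF z]
  note tc = smooth_manifold_chart[OF L c]
  note lag = lagrangian[OF s, unfolded lagrangian_immersion_def immersion_def]
  show ?thesis
  proof (rule lagrangian_subspace.intro)
    show "inner_form (g d (f (s, x)))" by (rule nk.g_inner_form[OF y])
    show "linear (J d (f (s, x)))" by (rule nk.J_linear[OF y])
    show "J d (f (s, x)) (J d (f (s, x)) u) = - u" for u by (rule nk.J_J[OF y])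
    show "g d (f (s, x)) (J d (f (s, x)) u) (J d (f (s, x)) v) = g d (f (s, x)) u v" for u v
      by (rule nk.J_isometry[OF y])
    show "alternating_3 (nk.\<sigma> (f (s, x)))" by (rule sigma_alternating[OF y])
    show "nk.\<sigma> (f (s, x)) u (J d (f (s, x)) v) w = nk.\<sigma> (f (s, x)) u v (J d (f (s, x)) w)" for u v w
      by (rule nk.sigma_J[OF y])
    show "nk.\<sigma> (f (s, x)) u v w = g d (f (s, x)) (nk.S (f (s, x)) u v) w" for u v w
      by (rule nk.\<sigma>_def)
    show "g d (f (s, x)) (nk.S (f (s, x)) u v) (nk.S (f (s, x)) u v) =
      \<alpha> * (g d (f (s, x)) u u * g d (f (s, x)) v v - (g d (f (s, x)) u v)\<^sup>2 - (g d (f (s, x)) u (J d (f (s, x)) v))\<^sup>2)" for u v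
      using type d y unfolding type_constant_def by blast
    have D: "(\<lambda>u. Df (s, x) (0, u)) = local_diff c d (F s) (chart_map c (chart_inv c x))"
      unfolding chart_map_inv[OF tc x] using local_diff_variation[OF c d z] by (intro ext) simp
    show "inj (\<lambda>u. Df (s, x) (0, u))"
      unfolding D using lag c d p chart_inv_dom[OF tc x] by blast
    show "linear (\<lambda>u. Df (s, x) (0, u))"
      using linear_compose[OF _ Df_linear[OF z], of "\<lambda>u. (0, u)"]
      by (simp add: o_def linear_iff)
    show "2 * DIM('f) = DIM('e)" using lag by blast
    show "g d (f (s, x)) (J d (f (s, x)) (Df (s, x) (0, u))) (Df (s, x) (0, v)) = 0" for u v
      using Omega_tangent[OF z, of u v] unfolding \<Omega>_def nk.omega_eq .
    show "nk.\<sigma> (f (s, x)) (Df (s, x) (0, u)) (Df (s, x) (0, v)) (Df (s, x) (0, w)) = 0" for u v w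
      by (rule sigma_tangent[OF z])
  qed
qed

context
  fixes t :: real
begin

definition "U = {x. (t, x) \<in> N}"

lemma U_open: "open U"
proof -
  have "open ((\<lambda>x. (t, x)) -` N)"
    by (rule open_vimage[OF N_open]) (intro continuous_intros)
  then show ?thesis by (simp add: U_def vimage_def)
qed

lemma metric_rep:
  assumes "y \<in> U"
  shows "pullback M (F t) g c y = lagrangian_subspace.h (g d (f (t, y))) (\<lambda>u. Df (t, y) (0, u))"
proof (intro ext)
  have ty: "(t, y) \<in> N" using assms by (simp add: U_def)
  show "pullback M (F t) g c y u v = lagrangian_subspace.h (g d (f (t, y))) (\<lambda>u. Df (t, y) (0, u)) u v" for u v
    unfolding lagrangian_subspace.h_def[OF tangent_space_lagrangian[OF ty]]
    by (rule pullback_chart(1)[OF tensorial_metric[OF almost_hermitian] c d ty])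
qed

lemma Psi_eq:
  assumes "y \<in> U"
  shows "\<Psi> (t, y) = lagrangian_subspace.\<psi> (J d (f (t, y))) (nk.\<sigma> (f (t, y))) (\<lambda>u. Df (t, y) (0, u))"
proof (intro ext)
  have ty: "(t, y) \<in> N" using assms by (simp add: U_def)
  show "\<Psi> (t, y) u v w =
     lagrangian_subspace.\<psi> (J d (f (t, y))) (nk.\<sigma> (f (t, y))) (\<lambda>u. Df (t, y) (0, u)) u v w" for u v w
    unfolding lagrangian_subspace.\<psi>_def[OF tangent_space_lagrangian[OF ty]] \<Psi>_def ..
qed

lemma variation_form_rep:
  assumes "y \<in> U" shows "variation_form M J g F t c y [u] = \<Omega> (t, y) (1, 0) (0, u)"
proof -
  have ty: "(t, y) \<in> N" using assms by (simp add: U_def)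
  show ?thesis
    using pullback_chart(2)[OF tensorial_kaehler_form[OF almost_hermitian] c d ty, of u]
    by (simp add: variation_form_def Let_def \<Omega>_def)
qed

lemma metric_smooth: "smooth_on U (\<lambda>y. pullback M (F t) g c y u v)"
proof -
  have "smooth_on N (\<lambda>z. g d (f z) (Df z (0, u)) (Df z (0, v)))"
  proof (rule smooth_on_bilinear_field[OF N_open, of "\<lambda>z. g d (f z)"])
    show "bilinear (g d (f z))" if "z \<in> N" for z by (rule nk.g_bilinear[OF f_image[OF that]])
  qed (rule pulled_back_smooth[OF nk.g_smooth] smooth_on_fd[OF f_smooth])+
  then have "smooth_on U (\<lambda>y. g d (f (t, y)) (Df (t, y) (0, u)) (Df (t, y) (0, v)))"
    by (rule smooth_on_slice[OF N_open U_open, rotated]) (simp add: U_def)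
  then show ?thesis
  proof (rule smooth_on_cong[OF U_open])
    fix y assume "y \<in> U"
    then show "g d (f (t, y)) (Df (t, y) (0, u)) (Df (t, y) (0, v)) = pullback M (F t) g c y u v"
      using pullback_chart(1)[OF tensorial_metric[OF almost_hermitian] c d, of t y u v] by (simp add: U_def)
  qed
qed

lemma variation_form_smooth: "smooth_on U (\<lambda>y. variation_form M J g F t c y [u])"
proof -
  have "smooth_on U (\<lambda>y. \<Omega> (t, y) (1, 0) (0, u))"
    by (rule smooth_on_slice[OF N_open U_open _ Omega_smooth]) (simp add: U_def)
  then show ?thesis
    by (rule smooth_on_cong[OF U_open]) (simp add: variation_form_rep)
qed

text \<open>\<open>d\<Omega>(\<partial>\<^sub>t, u, v)\<close> has three terms; the time derivative of \<open>\<Omega>(u, v)\<close> vanishes and the other two form \<open>-d\<theta>(u, v)\<close>.\<close>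

lemma ext_deriv_variation_form:
  assumes y: "y \<in> U"
  shows "ext_deriv_1 (\<lambda>y u. variation_form M J g F t c y [u]) y u v =
    - 3 * nk.\<sigma> (f (t, y)) (Df (t, y) (1, 0)) (Df (t, y) (0, u)) (Df (t, y) (0, v))"
proof -
  have ty: "(t, y) \<in> N" using y by (simp add: U_def)
  have slice: "fd (\<lambda>y. variation_form M J g F t c y [a]) y b = fd (\<lambda>z. \<Omega> z (1, 0) (0, a)) (t, y) (0, b)" for a b
  proof -
    have "fd (\<lambda>y. variation_form M J g F t c y [a]) y = fd (\<lambda>y. \<Omega> (t, y) (1, 0) (0, a)) y"
      by (rule fd_cong[OF U_open y]) (rule variation_form_rep)
    then show ?thesis
      using fd_slice[OF smooth_on_differentiable[OF Omega_smooth ty], of "(1, 0)" "(0, a)" b] by simp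
  qed
  have skew: "\<Omega> z (0, v) (1, 0) = - \<Omega> z (1, 0) (0, v)" if "z \<in> N" for z
    unfolding \<Omega>_def by (rule nk.omega_skew[OF f_image[OF that]])
  have "fd (\<lambda>z. \<Omega> z (0, v) (1, 0)) (t, y) = fd (\<lambda>z. - \<Omega> z (1, 0) (0, v)) (t, y)"
    by (rule fd_cong[OF N_open ty]) (rule skew)
  then have "fd (\<lambda>z. \<Omega> z (0, v) (1, 0)) (t, y) (0, u) = - fd (\<lambda>z. \<Omega> z (1, 0) (0, v)) (t, y) (0, u)"
    using fd_minus[OF smooth_on_differentiable[OF Omega_smooth ty]] by simp
  then have "ext_deriv_1 (\<lambda>y u. variation_form M J g F t c y [u]) y u v = - ext_deriv_2 \<Omega> (t, y) (1, 0) (0, u) (0, v)"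
    unfolding ext_deriv_1_def ext_deriv_2_def slice fd_Omega_tangent[OF ty] by simp
  then show ?thesis unfolding ext_deriv_Omega[OF ty] by simp
qed

lemma curl_eigenform_variation:
  "curl_eigenform (pullback M (F t) g) c U (\<lambda>y u. variation_form M J g F t c y [u]) (\<lambda>y. \<Psi> (t, y)) \<alpha>"
  if "t \<in> {-\<epsilon><..<\<epsilon>}"
proof (rule curl_eigenform.intro)
  have "2 * DIM('f) = DIM('e)" using lagrangian[OF that] by (simp add: lagrangian_immersion_def)
  then show "DIM('f) = 3" using dim by simp
  show "0 < \<alpha>" using type by (simp add: type_constant_def)
  show "open U" by (rule U_open)
  show "smooth_on U (\<lambda>y. pullback M (F t) g c y u v)" for u v by (rule metric_smooth)
  show "smooth_on U (\<lambda>y. variation_form M J g F t c y [u])" for u by (rule variation_form_smooth)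
  show "smooth_on U (\<lambda>y. \<Psi> (t, y) u v w)" for u v w
    by (rule smooth_on_slice[OF N_open U_open _ Psi_smooth]) (simp add: U_def)
  fix y assume y: "y \<in> U"
  then have ty: "(t, y) \<in> N" by (simp add: U_def)
  note lag = tangent_space_lagrangian[OF ty]
  show "inner_form (pullback M (F t) g c y)"
    unfolding metric_rep[OF y] by (rule lagrangian_subspace.h_inner_form[OF lag])
  show "alternating_3 (\<Psi> (t, y))"
    unfolding Psi_eq[OF y] by (rule lagrangian_subspace.psi_alternating[OF lag])
  show "(\<Psi> (t, y) a1 a2 a3)\<^sup>2 = \<alpha>"
    if "orthonormal_basis (pullback M (F t) g c y) {a1, a2, a3}" "a1 \<noteq> a2" "a1 \<noteq> a3" "a2 \<noteq> a3" for a1 a2 a3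
    using that unfolding Psi_eq[OF y] metric_rep[OF y] by (rule lagrangian_subspace.psi_norm[OF lag])
  show "\<exists>w. (\<forall>u. variation_form M J g F t c y [u] = pullback M (F t) g c y w u) \<and>
     (\<forall>u v. ext_deriv_1 (\<lambda>y u. variation_form M J g F t c y [u]) y u v = 3 * \<Psi> (t, y) w u v)"
  proof -
    obtain w where w: "\<And>u. g d (f (t, y)) (J d (f (t, y)) (Df (t, y) (1, 0))) (Df (t, y) (0, u)) = pullback M (F t) g c y w u"
      "\<And>u v. - nk.\<sigma> (f (t, y)) (Df (t, y) (1, 0)) (Df (t, y) (0, u)) (Df (t, y) (0, v)) = \<Psi> (t, y) w u v"
      using lagrangian_subspace.normal_contraction[OF lag, of "Df (t, y) (1, 0)"]
      unfolding Psi_eq[OF y] metric_rep[OF y] by blast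
    have "variation_form M J g F t c y [u] = pullback M (F t) g c y w u" for u
      unfolding variation_form_rep[OF y] \<Omega>_def nk.omega_eq by (rule w(1))
    moreover have "ext_deriv_1 (\<lambda>y u. variation_form M J g F t c y [u]) y u v = 3 * \<Psi> (t, y) w u v" for u v
      unfolding ext_deriv_variation_form[OF y] w(2)[symmetric] by simp
    ultimately show ?thesis by blast
  qed
qed

end

end

end

theorem theorem8p1:
  fixes M :: "('m::{t2_space, second_countable_topology}, 'e::euclidean_space) chart set"
    and L :: "('l::{t2_space, second_countable_topology}, 'f::euclidean_space) chart set"
    and J :: "('m, 'e) endo_field"
    and g :: "('m, 'e) bilinear_field"
    and F :: "real \<Rightarrow> 'l \<Rightarrow> 'm"
    and \<alpha> \<epsilon> t :: real
  assumes "smooth_manifold M"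
    and "DIM('e) = 6"
    and "strict_nearly_kaehler M J g"
    and "type_constant M J g \<alpha>"
    and "smooth_manifold L"
    and "\<epsilon> > 0"
    and "smooth_variation L M \<epsilon> F"
    and "\<And>s. s \<in> {- \<epsilon><..<\<epsilon>} \<Longrightarrow> lagrangian_immersion L M J g (F s)"
    and "t \<in> {- \<epsilon><..<\<epsilon>}"
  shows "\<forall>c\<in>L. \<forall>x\<in>chart_image c. \<forall>vs.
      codiff (pullback M (F t) g) (variation_form M J g F t) c x vs = 0 \<and>
      hodge_laplacian (pullback M (F t) g) (variation_form M J g F t) c x vs =
        9 * \<alpha> * variation_form M J g F t c x vs"
proof (intro ballI allI)
  fix c x vs assume c: "c \<in> L" and x: "x \<in> chart_image c"
  interpret lagrangian_variation M L F \<epsilon> J g \<alpha>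
    by unfold_locales (use assms in \<open>simp_all add: strict_nearly_kaehler_def\<close>)
  let ?p = "F t (chart_inv c x)"
  have "chart_inv c x \<in> points L"
    using chart_inv_dom[OF smooth_manifold_chart[OF assms(5) c] x] c by (auto simp: points_def)
  from chart_at_contains[OF variation_range[OF assms(9) this]]
  have d: "chart_at M ?p \<in> M" and p: "?p \<in> chart_dom (chart_at M ?p)" by simp_all
  \<comment> \<open>The chart chosen at the image of \<open>x\<close> serves for all points near \<open>x\<close>.\<close>
  have xU: "x \<in> U c (chart_at M ?p) t"
    using assms(9) x p by (simp add: U_def[OF c d] rep_dom_def)
  note eigen = curl_eigenform_variation[OF c d assms(9)]
  have form: "variation_form M J g F t c y ws =
     (case ws of [u] \<Rightarrow> variation_form M J g F t c y [u] | _ \<Rightarrow> 0)" for y ws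
    by (auto simp: variation_form_def split: list.split)
  show "codiff (pullback M (F t) g) (variation_form M J g F t) c x vs = 0 \<and>
      hodge_laplacian (pullback M (F t) g) (variation_form M J g F t) c x vs =
        9 * \<alpha> * variation_form M J g F t c x vs"
    using curl_eigenform.coclosed[where \<theta> = "variation_form M J g F t", OF eigen form xU]
      curl_eigenform.hodge_laplacian_eigenform[where \<theta> = "variation_form M J g F t", OF eigen form xU]
    by blast
qed

end
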